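(* Let $n>1$ be an integer and let $X_1,X_2,\dots,X_m\in\mathbb{R}^n$ be points lying on some affine hyperplane of $\mathbb{R}^n$. Then there exists a finite set $L(X_1,\dots,X_m)\subseteq\mathbb{R}^n$ containing $X_1,\dots,X_m$ such that for every map $f:L(X_1,\dots,X_m)\to\mathbb{R}^n$ preserving all unit distances, the points $f(X_1),\dots,f(X_m)$ lie on some affine hyperplane of $\mathbb{R}^n$. Moreover, if $X_1,\dots,X_m\in\mathbf{F}^n$, then $L(X_1,\dots,X_m)$ can be chosen to be a subset of $\mathbf{F}^n$.
   Context: $\mathbf{F}\subseteq\mathbb{R}$ denotes the field of real numbers constructible by means of ruler and compass (equivalently, the smallest subfield of $\mathbb{R}$ closed under taking square roots of its non-negative elements). $|\cdot|$ is the Euclidean norm on $\mathbb{R}^n$. A map $f:S\to\mathbb{R}^n$ with $S\subseteq\mathbb{R}^n$ preserves all unit distances if for all $u,v\in S$, $|u-v|=1$ implies $|f(u)-f(v)|=1$. Maps are arbitrary functions (no continuity or injectivity is assumed). An affine hyperplane of $\mathbb{R}^n$ is an affine subspace of dimension $n-1$. *)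

theory Defs
  imports "HOL-Analysis.Analysis"
begin

text \<open>
  The field \<open>\<^bold>F\<close> of real numbers constructible by ruler and compass, as the
  smallest subfield of the reals closed under square roots of nonnegative elements. (The rule
  \<open>inverse\<close> needs no side condition, since \<open>inverse 0 = 0\<close>.)
\<close>

inductive_set constructible :: "real set" where
  zero: "0 \<in> constructible"
| one: "1 \<in> constructible"
| add: "x \<in> constructible \<Longrightarrow> y \<in> constructible \<Longrightarrow> x + y \<in> constructible"
| uminus: "x \<in> constructible \<Longrightarrow> - x \<in> constructible"
| mult: "x \<in> constructible \<Longrightarrow> y \<in> constructible \<Longrightarrow> x * y \<in> constructible"
| inverse: "x \<in> constructible \<Longrightarrow> inverse x \<in> constructible"
| sqrt: "x \<in> constructible \<Longrightarrow> 0 \<le> x \<Longrightarrow> sqrt x \<in> constructible"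

definition constructible_points :: "(real ^ 'n) set" where
  "constructible_points = {x. \<forall>i. x $ i \<in> constructible}"

definition affine_hyperplane :: "(real ^ 'n) set \<Rightarrow> bool" where
  "affine_hyperplane H \<longleftrightarrow> affine H \<and> aff_dim H = int CARD('n) - 1"

text \<open>
  Maps defined on \<open>S\<close> are represented by total functions whose values outside \<open>S\<close> are ignored.
\<close>

definition preserves_unit_distances :: "(real ^ 'n) set \<Rightarrow> (real ^ 'n \<Rightarrow> real ^ 'n) \<Rightarrow> bool" where
  "preserves_unit_distances S f \<longleftrightarrow>
     (\<forall>u\<in>S. \<forall>v\<in>S. norm (u - v) = 1 \<longrightarrow> norm (f u - f v) = 1)"

end

theory Submission
  imports Defs
begin

text \<open>
  Call a property of maps \<open>f\<close> forced if finitely many points of \<open>K\<^sup>n\<close> (\<open>K\<close> the reals or the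
  constructible numbers) suffice for it; forced properties are those that hold eventually for a
  filter. Gluing unit simplices forces the distances \<open>sqrt (2 + 2/n)\<close> and \<open>\<delta> = 2/n\<close>, and then the
  collinearity of points with distances \<open>1\<close>, \<open>\<delta>\<close>, \<open>1 + \<delta>\<close>. Hence arithmetic progressions are
  preserved, and similar triangles give all rational distances.

  If \<open>n > 2\<close>, 3-4-5 rectangles transport a vector \<open>w\<close> of length 4 normal to the hyperplane along
  chains of steps of length 3 inside the hyperplane, so \<open>f (x + w) - f x\<close> is a common normal of all
  the image points.

  If \<open>n = 2\<close>, the hyperplane is a line with direction \<open>e\<close>, and unit rhombi force \<open>v \<mapsto> f (p + v) - f p\<close>
  to be additive. Read as a complex number normalised to 1 at \<open>e\<close>, the image \<open>z t\<close> of \<open>t e\<close>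
  satisfies \<open>z (1/t) = 1 / cnj (z t)\<close>; by Hua's identity \<open>z\<close> preserves squares, hence
  \<open>z t * z (1/t) = 1\<close>, and \<open>z t\<close> is real.
\<close>

subsection \<open>Simplices, rhombi and rectangles\<close>

text \<open>A nonzero \<open>w\<close> would complete \<open>p\<close>, \<open>q\<close> to three
  independent vectors in dimension 2. Later this proves planar vector equations by testing against
  two orthogonal directions.\<close>

lemma orthogonal_pair_complement_trivial:
  fixes p q w :: "real ^ 'n"
  assumes "CARD('n) = 2" "p \<noteq> 0" "q \<noteq> 0" "p \<bullet> q = 0" "w \<bullet> p = 0" "w \<bullet> q = 0"
  shows "w = 0"
proof (rule ccontr)
  assume "w \<noteq> 0"
  have ne: "p \<noteq> q" "w \<noteq> p" "w \<noteq> q" using assms by auto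
  have "pairwise orthogonal {w, p, q}"
    using assms by (auto simp: pairwise_def orthogonal_def inner_commute)
  then have "independent {w, p, q}"
    using assms \<open>w \<noteq> 0\<close> by (intro pairwise_orthogonal_independent) auto
  then have "card {w, p, q} \<le> 2"
    using independent_bound[of "{w,p,q}"] assms(1) by simp
  then show False using ne by simp
qed

text \<open>\<open>B + C - A - D\<close>, twice the difference of the midpoints of the diagonals, is
  orthogonal to both diagonals, which are orthogonal to each other. The two inequations exclude
  folded rhombi.\<close>

lemma rhombus_of_unit_sides:
  fixes A B C D :: "real ^ 'n"
  assumes card: "CARD('n) = 2"
    and "norm (B - A) = 1" "norm (C - A) = 1" "norm (D - B) = 1" "norm (D - C) = 1"
    and "A \<noteq> D" "B \<noteq> C"
  shows "D - B = C - A"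
proof -
  have sq: "(B - A) \<bullet> (B - A) = 1" "(C - A) \<bullet> (C - A) = 1"
    "(D - B) \<bullet> (D - B) = 1" "(D - C) \<bullet> (D - C) = 1"
    using assms by (simp_all add: norm_eq_1)
  have "B + C - A - D = 0"
  proof (rule orthogonal_pair_complement_trivial[OF card, of "B - C" "D - A"])
    show "B - C \<noteq> 0" "D - A \<noteq> 0" using assms by auto
    show "(B - C) \<bullet> (D - A) = 0"
      "(B + C - A - D) \<bullet> (B - C) = 0"
      "(B + C - A - D) \<bullet> (D - A) = 0"
      using sq by (simp_all add: inner_diff_left inner_diff_right inner_add_left inner_add_right inner_commute)
  qed
  then show ?thesis by (simp add: algebra_simps)
qed

text \<open>The six distances determine the inner products of \<open>a\<close>, \<open>b\<close>,
  \<open>c\<close>, and these make the squared length of \<open>c - a - b\<close> vanish; this works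
  in every dimension.\<close>

lemma rectangle_3_4_5:
  fixes A B C D :: "'a :: real_inner"
  assumes "norm (B - A) = 3" "norm (C - A) = 4" "norm (B - C) = 5"
    and "norm (D - A) = 5" "norm (D - B) = 4" "norm (D - C) = 3"
  shows "D - B = C - A" "(B - A) \<bullet> (C - A) = 0"
proof -
  define a b c where "a = B - A" and "b = C - A" and "c = D - A"
  have sq: "a \<bullet> a = 9" "b \<bullet> b = 16" "(a - b) \<bullet> (a - b) = 25"
    "c \<bullet> c = 25" "(c - a) \<bullet> (c - a) = 16" "(c - b) \<bullet> (c - b) = 9"
    using assms unfolding dot_square_norm a_def b_def c_def by simp_all
  then have ab: "a \<bullet> b = 0" and "c \<bullet> a = 9" "c \<bullet> b = 16"
    by (simp_all add: inner_diff_left inner_diff_right inner_commute)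
  with sq have "(c - a - b) \<bullet> (c - a - b) = 0"
    by (simp add: inner_diff_left inner_diff_right inner_commute)
  then have "c - a = b" by simp
  then show "D - B = C - A" by (simp add: a_def b_def c_def)
  show "(B - A) \<bullet> (C - A) = 0" using ab by (simp add: a_def b_def)
qed

text \<open>For \<open>n\<close> the dimension, \<open>a\<^sup>2 * (n - 1) / (2 * n)\<close> is the
  squared circumradius of a simplex with \<open>n\<close> vertices and edge \<open>a\<close>, so
  \<open>h\<close> is the distance of \<open>x\<close> and \<open>y\<close> from its centroid. The
  symmetric Gram matrix of the \<open>u i\<close> puts \<open>w\<close> on the axis through the
  centroid, so the two points agree or are mirror images.\<close>

lemma regular_simplex_equidistant:
  fixes P :: "'n::finite \<Rightarrow> real ^ 'n" and x y :: "real ^ 'n"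
  assumes a: "a > 0" and h: "h > 0"
    and h2: "h\<^sup>2 = b\<^sup>2 - a\<^sup>2 * (real CARD('n) - 1) / (2 * real CARD('n))"
    and P: "\<And>i j. i \<noteq> j \<Longrightarrow> norm (P i - P j) = a"
    and x: "\<And>i. norm (x - P i) = b" and y: "\<And>i. norm (y - P i) = b"
  shows "norm (x - y) = 0 \<or> norm (x - y) = 2 * h"
proof -
  define n where "n = real CARD('n)"
  have n: "n > 0" unfolding n_def by simp
  define u where "u i = P i - x" for i
  define w where "w = y - x"
  define g where "g = b\<^sup>2 - a\<^sup>2 / 2"
  \<comment> \<open>This is the eigenvalue of the Gram matrix of the \<open>u i\<close> on constant
    vectors; it is nonzero because \<open>h > 0\<close>.\<close>
  have gh: "a\<^sup>2 / 2 + g * n = n * h\<^sup>2"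
    using n h2 unfolding g_def n_def[symmetric] by (simp add: field_simps)
  have uu: "u i \<bullet> u i = b\<^sup>2" for i
    using x[of i] by (simp add: u_def dot_square_norm norm_minus_commute)
  have uv: "u i \<bullet> u j = g" if "i \<noteq> j" for i j
  proof -
    have "(u i - u j) \<bullet> (u i - u j) = a\<^sup>2"
      using P[OF that] by (simp add: u_def dot_square_norm)
    then show ?thesis using uu[of i] uu[of j]
      by (simp add: inner_diff_left inner_diff_right inner_commute g_def)
  qed
  have comb: "(\<Sum>i\<in>UNIV. v i *\<^sub>R u i) \<bullet> u j = a\<^sup>2 / 2 * v j + g * (\<Sum>i\<in>UNIV. v i)"
    for v :: "'n \<Rightarrow> real" and j
  proof -
    have "(\<Sum>i\<in>UNIV. v i *\<^sub>R u i) \<bullet> u j = (\<Sum>i\<in>UNIV. v i * (u i \<bullet> u j))"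
      by (simp add: inner_sum_left)
    also have "\<dots> = (\<Sum>i\<in>UNIV. g * v i + (if i = j then a\<^sup>2 / 2 * v j else 0))"
      by (intro sum.cong) (auto simp: uu uv g_def algebra_simps)
    also have "\<dots> = a\<^sup>2 / 2 * v j + g * (\<Sum>i\<in>UNIV. v i)"
      by (simp add: sum.distrib sum_distrib_left)
    finally show ?thesis .
  qed
  have const: "v i = v j"
    if "\<And>j. a\<^sup>2 / 2 * v j + g * (\<Sum>i\<in>UNIV. v i) = k" for v :: "'n \<Rightarrow> real" and k i j
  proof -
    have "a\<^sup>2 / 2 * v i = a\<^sup>2 / 2 * v j" using that[of i] that[of j] by linarith
    then show ?thesis using a by simp
  qed
  define F where "F v = (\<Sum>i\<in>UNIV. v $ i *\<^sub>R u i)" for v :: "real ^ 'n"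
  have linF: "linear F" unfolding F_def
    by (intro linearI) (simp_all add: scaleR_left_distrib sum.distrib scaleR_sum_right)
  have "v = 0" if "F v = 0" for v
  proof -
    have z: "a\<^sup>2 / 2 * v $ j + g * (\<Sum>i\<in>UNIV. v $ i) = 0" for j
      using comb[of "\<lambda>i. v $ i" j] that by (simp add: F_def)
    have "v $ i = 0" for i
    proof -
      have "\<And>j. v $ j = v $ i" using const[of "\<lambda>i. v $ i"] z by blast
      then have "(\<Sum>j\<in>UNIV. v $ j) = (\<Sum>j\<in>(UNIV :: 'n set). v $ i)"
        by (intro sum.cong refl)
      then have "(\<Sum>j\<in>UNIV. v $ j) = n * v $ i" by (simp add: n_def)
      then have "(a\<^sup>2 / 2 + g * n) * v $ i = 0" using z[of i] by (simp add: algebra_simps)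
      then show ?thesis using n h gh by simp
    qed
    then show ?thesis by (simp add: vec_eq_iff)
  qed
  then have "inj F" using linF by (simp add: linear_injective_0)
  then have "surj F" using linF by (simp add: linear_injective_imp_surjective)
  then obtain v where v: "w = F v" by (metis surjD)
  have wu: "w \<bullet> u j = w \<bullet> w / 2" for j
  proof -
    have "(w - u j) \<bullet> (w - u j) = b\<^sup>2"
      using y[of j] by (simp add: w_def u_def dot_square_norm)
    then show ?thesis using uu[of j] by (simp add: inner_diff_left inner_diff_right inner_commute)
  qed
  obtain i0 :: 'n where True by simp
  define c where "c = v $ i0"
  have "v $ j = c" for j
    using const[of "\<lambda>i. v $ i" "w \<bullet> w / 2" j i0] comb[of "\<lambda>i. v $ i"] wu
    by (simp add: v F_def c_def)
  then have wc: "w = c *\<^sub>R (\<Sum>i\<in>UNIV. u i)" and sv: "\<And>j. w \<bullet> u j = a\<^sup>2 / 2 * c + g * (n * c)"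
    using comb[of "\<lambda>i. c"] by (simp_all add: v F_def scaleR_sum_right n_def)
  have ww: "w \<bullet> w = 2 * c * (n * h\<^sup>2)"
    using wu[of i0] sv[of i0] gh[symmetric] by (simp add: algebra_simps)
  \<comment> \<open>Pairing \<open>w\<close> with its own expansion leaves \<open>w = 0\<close> or
    \<open>c = 2 / n\<close>; the latter takes \<open>x\<close> to its mirror image.\<close>
  have "w \<bullet> w = c * (\<Sum>i\<in>UNIV. w \<bullet> u i)"
    by (subst (2) wc) (simp add: inner_sum_right)
  also have "\<dots> = c * (n * (w \<bullet> w / 2))" by (simp add: wu n_def)
  finally have "w \<bullet> w = 0 \<or> c = 2 / n" using n by (auto simp: field_simps)
  then show ?thesis
  proof
    assume "c = 2 / n"
    then have "w \<bullet> w = (2 * h)\<^sup>2" using ww n by (simp add: power2_eq_square)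
    then have "norm w = 2 * h"
      using h power2_eq_imp_eq[of "norm w" "2 * h"] by (simp only: dot_square_norm) simp
    then show ?thesis by (simp add: w_def norm_minus_commute)
  qed (simp add: w_def)
qed

text \<open>\<open>p\<close> and the \<open>Q i\<close> form the regular simplex inscribed in the
  unit sphere about \<open>z\<close>, so the vectors from \<open>z\<close> to its vertices sum to 0.
  Hence \<open>y - z\<close>, having equal inner products with all \<open>u i\<close>, has a known
  one with \<open>u0\<close>, and this is the equality case of Cauchy-Schwarz.\<close>

lemma regular_simplex_reflected_centre:
  fixes Q :: "'n::finite \<Rightarrow> 'a::real_inner" and p y z :: 'a
  defines "n \<equiv> real CARD('n)"
  assumes Q: "\<And>i j. i \<noteq> j \<Longrightarrow> norm (Q i - Q j) = sqrt (2 + 2 / n)"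
    and p: "\<And>i. norm (p - Q i) = sqrt (2 + 2 / n)"
    and z: "\<And>i. norm (z - Q i) = 1" and zp: "norm (z - p) = 1"
    and y: "\<And>i. norm (y - Q i) = 1" and yz: "norm (y - z) = 2 / n"
  shows "y - z = (2 / n) *\<^sub>R (z - p)"
proof -
  have n: "n > 0" unfolding n_def by simp
  have n2: "2 + 2 / n > 0" using n by (simp add: add_pos_pos)
  define u where "u i = Q i - z" for i
  define u0 where "u0 = p - z"
  define w where "w = y - z"
  have uu: "u i \<bullet> u i = 1" "u0 \<bullet> u0 = 1" for i
    using z[of i] zp by (simp_all add: u_def u0_def dot_square_norm norm_minus_commute)
  have uv: "u i \<bullet> u j = - 1 / n" if "i \<noteq> j" for i j
  proof -
    have "(u i - u j) \<bullet> (u i - u j) = 2 + 2 / n"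
      using Q[OF that] n2 by (simp add: u_def dot_square_norm)
    then show ?thesis using uu(1)[of i] uu(1)[of j]
      by (simp add: inner_diff_left inner_diff_right inner_commute)
  qed
  have u0v: "u0 \<bullet> u j = - 1 / n" for j
  proof -
    have "(u0 - u j) \<bullet> (u0 - u j) = 2 + 2 / n"
      using p[of j] n2 by (simp add: u_def u0_def dot_square_norm)
    then show ?thesis using uu(1)[of j] uu(2)
      by (simp add: inner_diff_left inner_diff_right inner_commute)
  qed
  define s where "s = (\<Sum>i\<in>UNIV. u i)"
  have su: "s \<bullet> u j = 1 / n" for j
  proof -
    have "s \<bullet> u j = (\<Sum>i\<in>UNIV. - 1 / n + (if i = j then 1 + 1 / n else 0))"
      unfolding s_def inner_sum_left by (intro sum.cong) (auto simp: uu uv)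
    also have "\<dots> = 1 / n" unfolding sum.distrib using n by (simp add: n_def)
    finally show ?thesis .
  qed
  have "s \<bullet> s = 1"
    using n by (subst (2) s_def) (simp add: inner_sum_right su n_def)
  moreover have "s \<bullet> u0 = -1"
    using n u0v unfolding s_def inner_sum_left by (simp add: inner_commute[of _ u0] n_def)
  ultimately have "(s + u0) \<bullet> (s + u0) = 0"
    using uu by (simp add: inner_add_left inner_add_right inner_commute)
  then have s: "s = - u0" by (simp add: eq_neg_iff_add_eq_0)
  have ww: "w \<bullet> w = (2 / n)\<^sup>2" using yz by (simp add: w_def dot_square_norm)
  have wu: "w \<bullet> u j = (2 / n)\<^sup>2 / 2" for j
  proof -
    have "(w - u j) \<bullet> (w - u j) = 1"
      using y[of j] by (simp add: w_def u_def dot_square_norm)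
    then show ?thesis using uu(1)[of j] ww
      by (simp add: inner_diff_left inner_diff_right inner_commute)
  qed
  have "w \<bullet> s = n * ((2 / n)\<^sup>2 / 2)"
    by (simp add: s_def inner_sum_right wu n_def)
  then have "w \<bullet> u0 = - (2 / n)" using n by (simp add: s power2_eq_square)
  then have "(w + (2 / n) *\<^sub>R u0) \<bullet> (w + (2 / n) *\<^sub>R u0) = 0"
    using ww uu by (simp add: inner_add_left inner_add_right inner_commute power2_eq_square)
  then have "w = - ((2 / n) *\<^sub>R u0)" by (simp add: eq_neg_iff_add_eq_0)
  then show ?thesis by (simp add: w_def u0_def scaleR_diff_right)
qed

section \<open>Complex coordinates on the plane\<close>

definition planar_chart :: "(real ^ 'n \<Rightarrow> complex) \<Rightarrow> bool" where
  "planar_chart \<phi> \<longleftrightarrow> linear \<phi> \<and> (\<forall>x. cmod (\<phi> x) = norm x)"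

lemma planar_chart_exists:
  fixes E :: "real ^ 'n"
  assumes "CARD('n) = 2" "norm E = 1"
  obtains \<phi> where "planar_chart \<phi>" "\<phi> E = 1"
proof -
  have dim: "DIM(real ^ 'n) = DIM(complex)" using assms(1) by (simp add: DIM_complex)
  obtain \<psi> :: "real ^ 'n \<Rightarrow> complex" where \<psi>: "linear \<psi>" "\<And>x. norm (\<psi> x) = norm x"
    using isomorphisms_UNIV_UNIV[OF dim] by metis
  \<comment> \<open>Multiplying by the conjugate of the unit number \<open>\<psi> E\<close> rotates
    it to 1.\<close>
  define \<phi> where "\<phi> x = cnj (\<psi> E) * \<psi> x" for x
  show ?thesis
  proof (rule that[of \<phi>])
    have "linear \<phi>"
      unfolding \<phi>_def using \<psi>(1)
      by (intro linearI) (simp_all add: linear_add linear_scale algebra_simps)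
    then show "planar_chart \<phi>"
      using assms(2) \<psi>(2) by (simp add: planar_chart_def \<phi>_def norm_mult)
    show "\<phi> E = 1"
      using assms(2) \<psi>(2)[of E] by (simp add: \<phi>_def mult.commute[of "cnj _"] complex_norm_square[symmetric])
  qed
qed

text \<open>\<open>z * cnj z\<close> is the squared norm, so inversion in the unit circle carries a
  conjugation; this is what later makes images real.\<close>

lemma planar_chart_inversion:
  assumes "planar_chart \<phi>" "x \<noteq> 0"
  shows "\<phi> ((1 / (x \<bullet> x)) *\<^sub>R x) = inverse (cnj (\<phi> x))"
proof -
  have "cmod (\<phi> x) = norm x" "linear \<phi>" using assms by (auto simp: planar_chart_def)
  then have "\<phi> ((1 / (x \<bullet> x)) *\<^sub>R x) * cnj (\<phi> x) = of_real (1 / (x \<bullet> x)) * (\<phi> x * cnj (\<phi> x))"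
    by (simp add: linear_scale) (simp add: scaleR_conv_of_real)
  also have "\<phi> x * cnj (\<phi> x) = of_real (x \<bullet> x)"
    using \<open>cmod (\<phi> x) = norm x\<close> by (simp add: complex_norm_square[symmetric] power2_norm_eq_inner)
  finally have "\<phi> ((1 / (x \<bullet> x)) *\<^sub>R x) * cnj (\<phi> x) = 1" using assms(2) by simp
  then show ?thesis by (metis inverse_unique mult.commute)
qed

lemma normal_line_inversion:
  fixes x y b :: "real ^ 'n"
  assumes "CARD('n) = 2" "b \<noteq> 0" "x \<bullet> b = 0" "y \<bullet> b = 0" "x \<bullet> y = 1"
  shows "y = (1 / (x \<bullet> x)) *\<^sub>R x"
proof -
  have x: "x \<noteq> 0" using assms(5) by auto
  have "y - (1 / (x \<bullet> x)) *\<^sub>R x = 0"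
    by (rule orthogonal_pair_complement_trivial[OF assms(1) x assms(2) assms(3)])
      (use assms x in \<open>simp_all add: inner_diff_left inner_commute[of y x]\<close>)
  then show ?thesis by simp
qed

subsection \<open>Points over a Euclidean field\<close>

text \<open>The parameter \<open>dim_type\<close> pins the dimension, on which \<open>rigid\<close> below depends although its
  type does not mention it.\<close>

locale euclidean_field =
  fixes K :: "real set" and dim_type :: "'n::finite itself"
  assumes K_0 [simp]: "0 \<in> K" and K_1 [simp]: "1 \<in> K"
    and K_add [intro, simp]: "\<And>x y. x \<in> K \<Longrightarrow> y \<in> K \<Longrightarrow> x + y \<in> K"
    and K_uminus [intro, simp]: "\<And>x. x \<in> K \<Longrightarrow> - x \<in> K"
    and K_mult [intro, simp]: "\<And>x y. x \<in> K \<Longrightarrow> y \<in> K \<Longrightarrow> x * y \<in> K"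
    and K_inverse [intro, simp]: "\<And>x. x \<in> K \<Longrightarrow> inverse x \<in> K"
    and K_sqrt [intro, simp]: "\<And>x. x \<in> K \<Longrightarrow> 0 \<le> x \<Longrightarrow> sqrt x \<in> K"
    and card_ge_2: "CARD('n) \<ge> 2"
begin

lemma K_diff [intro, simp]: "x \<in> K \<Longrightarrow> y \<in> K \<Longrightarrow> x - y \<in> K"
  using K_add[of x "- y"] by simp

lemma K_divide [intro, simp]: "x \<in> K \<Longrightarrow> y \<in> K \<Longrightarrow> x / y \<in> K"
  by (simp add: divide_inverse)

lemma K_power [intro, simp]: "x \<in> K \<Longrightarrow> x ^ k \<in> K"
  by (induction k) auto

lemma K_of_nat [simp]: "real k \<in> K"
  by (induction k) auto

lemma K_numeral [simp]: "numeral k \<in> K"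
  using K_of_nat[of "numeral k"] by simp

lemma K_sum [intro]: "(\<And>i. i \<in> I \<Longrightarrow> g i \<in> K) \<Longrightarrow> sum g I \<in> K"
  by (induction I rule: infinite_finite_induct) auto

definition pts :: "(real ^ 'n) set" where
  "pts = {x. \<forall>i. x $ i \<in> K}"

lemma pts_0 [simp]: "0 \<in> pts" and pts_axis [simp]: "axis i 1 \<in> pts"
  by (auto simp: pts_def axis_def)

lemma pts_add [intro, simp]: "x \<in> pts \<Longrightarrow> y \<in> pts \<Longrightarrow> x + y \<in> pts"
  and pts_diff [intro, simp]: "x \<in> pts \<Longrightarrow> y \<in> pts \<Longrightarrow> x - y \<in> pts"
  and pts_uminus [intro, simp]: "x \<in> pts \<Longrightarrow> - x \<in> pts"
  and pts_scaleR [intro, simp]: "c \<in> K \<Longrightarrow> x \<in> pts \<Longrightarrow> c *\<^sub>R x \<in> pts"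
  by (auto simp: pts_def)

lemma pts_sum [intro]: "(\<And>i. i \<in> I \<Longrightarrow> g i \<in> pts) \<Longrightarrow> sum g I \<in> pts"
  by (induction I rule: infinite_finite_induct) auto

lemma inner_pts [intro, simp]: "x \<in> pts \<Longrightarrow> y \<in> pts \<Longrightarrow> x \<bullet> y \<in> K"
  by (auto simp: pts_def inner_vec_def)

lemma norm_pts [intro, simp]: "x \<in> pts \<Longrightarrow> norm x \<in> K"
  by (auto simp: norm_eq_sqrt_inner)

text \<open>Gram-Schmidt without normalisation uses field operations only and so stays over
  \<open>K\<close>. The set \<open>B\<close> may contain 0, which is harmless.\<close>

lemma orthogonal_basis_pts:
  assumes "finite S" "S \<subseteq> pts"
  obtains B where "finite B" "B \<subseteq> pts" "pairwise orthogonal B" "span B = span S"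
  using assms
proof (induction S arbitrary: thesis rule: finite_induct)
  case empty
  show ?case using empty(1)[of "{}"] by simp
next
  case (insert s S)
  obtain B where B: "finite B" "B \<subseteq> pts" "pairwise orthogonal B" "span B = span S"
    using insert.IH insert.prems by blast
  define a where "a = s - (\<Sum>b\<in>B. (b \<bullet> s / (b \<bullet> b)) *\<^sub>R b)"
  show ?case
  proof (rule insert.prems(1)[of "insert a B"])
    show "finite (insert a B)" using B by simp
    show "insert a B \<subseteq> pts"
      using B insert.prems(2) unfolding a_def by (auto intro!: pts_diff pts_sum pts_scaleR)
    show "pairwise orthogonal (insert a B)"
      using Gram_Schmidt_step[OF B(3), of _ s] B(3)
      by (auto simp: pairwise_insert a_def orthogonal_commute span_base)
    have "s - a \<in> span B"
      unfolding a_def by (simp add: span_sum span_scale span_base)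
    then have "span (insert a B) = span (insert s B)"
      using eq_span_insert_eq[of s a B] by simp
    then show "span (insert a B) = span (insert s S)"
      using B(4) by (simp add: span_insert)
  qed
qed

text \<open>Some coordinate axis leaves the span; its component orthogonal to the span is again over
  \<open>K\<close>, and square roots in \<open>K\<close> allow it to be normalised.\<close>

lemma exists_orthogonal_unit_pts:
  assumes "finite S" "S \<subseteq> pts" "span S \<noteq> UNIV"
  obtains v where "v \<in> pts" "norm v = 1" "\<And>s. s \<in> S \<Longrightarrow> v \<bullet> s = 0"
proof -
  obtain B where B: "finite B" "B \<subseteq> pts" "pairwise orthogonal B" "span B = span S"
    using orthogonal_basis_pts assms by blast
  have "\<exists>i. axis i 1 \<notin> span S"
  proof (rule ccontr)
    assume "\<nexists>i. axis i 1 \<notin> span S"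
    then have "Basis \<subseteq> span S" by (auto simp: Basis_vec_def)
    then have "span Basis \<subseteq> span S" by (rule span_minimal) simp
    then show False using assms(3) by auto
  qed
  then obtain i where i: "axis i 1 \<notin> span S" by blast
  define a where "a = axis i 1 - (\<Sum>b\<in>B. (b \<bullet> axis i 1 / (b \<bullet> b)) *\<^sub>R b)"
  have a: "a \<in> pts" using B(2) unfolding a_def by (auto intro!: pts_diff pts_sum pts_scaleR)
  have "a \<noteq> 0"
  proof
    assume "a = 0"
    then have "axis i 1 = (\<Sum>b\<in>B. (b \<bullet> axis i 1 / (b \<bullet> b)) *\<^sub>R b)" by (simp add: a_def)
    also have "\<dots> \<in> span B" by (intro span_sum span_scale span_base)
    finally show False using i B(4) by simp
  qed
  have orth: "a \<bullet> s = 0" if "s \<in> S" for s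
  proof -
    have "s \<in> span B" using that B(4) by (simp add: span_base)
    then show ?thesis
      using Gram_Schmidt_step[OF B(3), of s "axis i 1"]
      by (simp add: a_def orthogonal_def inner_commute)
  qed
  show ?thesis
  proof (rule that[of "(1 / norm a) *\<^sub>R a"])
    show "(1 / norm a) *\<^sub>R a \<in> pts" using a by (intro pts_scaleR K_divide norm_pts) auto
  qed (use \<open>a \<noteq> 0\<close> orth in auto)
qed

lemma exists_orthogonal_unit_pts_card:
  assumes "finite S" "S \<subseteq> pts" "card S < CARD('n)"
  obtains v where "v \<in> pts" "norm v = 1" "\<And>s. s \<in> S \<Longrightarrow> v \<bullet> s = 0"
proof -
  have "dim S < CARD('n)" using dim_le_card'[OF assms(1)] assms(3) by linarith
  then have "span S \<noteq> UNIV" using dim_eq_full[of S] by auto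
  then show ?thesis using exists_orthogonal_unit_pts[OF assms(1,2)] that by blast
qed

text \<open>For \<open>a \<noteq> b\<close> take the reflection in the hyperplane orthogonal to
  \<open>a - b\<close>; its formula involves only field operations.\<close>

lemma exists_linear_isometry_pts:
  assumes "a \<in> pts" "b \<in> pts" "norm a = norm b"
  obtains R where "linear R" "\<And>x. norm (R x) = norm x" "\<And>x. x \<in> pts \<Longrightarrow> R x \<in> pts" "R a = b"
proof (cases "a = b")
  case True
  show ?thesis by (rule that[of "\<lambda>x. x"]) (auto simp: True linear_ident)
next
  case False
  define w where "w = a - b"
  have w: "w \<in> pts" "w \<bullet> w \<noteq> 0" using False assms by (auto simp: w_def)
  define R where "R x = x - (2 * (x \<bullet> w) / (w \<bullet> w)) *\<^sub>R w" for x
  have ab: "a \<bullet> a = b \<bullet> b" using assms by (simp add: dot_square_norm)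
  show ?thesis
  proof (rule that[of R])
    show "linear R" unfolding R_def
      by (intro linearI) (simp_all add: inner_add_left algebra_simps add_divide_distrib)
    fix x
    have "R x \<bullet> R x = x \<bullet> x"
      using w(2) by (simp add: R_def inner_diff_left inner_diff_right inner_commute field_simps)
    then show "norm (R x) = norm x" by (simp add: norm_eq)
    show "x \<in> pts \<Longrightarrow> R x \<in> pts" using w unfolding R_def by (intro pts_diff pts_scaleR) auto
  next
    have "2 * (a \<bullet> w) = w \<bullet> w"
      using ab by (simp add: w_def inner_diff_left inner_diff_right inner_commute)
    then show "R a = b" using w(2) by (simp add: R_def) (simp add: w_def)
  qed
qed

lemma exists_triangle_pts:
  assumes xy: "x \<in> pts" "y \<in> pts" "x \<noteq> y" and bc: "b \<in> K" "c \<in> K" "0 \<le> b" "0 \<le> c"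
    and tri: "\<bar>b - c\<bar> \<le> norm (x - y)" "norm (x - y) \<le> b + c"
  obtains z where "z \<in> pts" "norm (x - z) = b" "norm (y - z) = c"
proof -
  define a where "a = norm (x - y)"
  have a: "a > 0" "a \<in> K" using xy by (auto simp: a_def)
  define e where "e = (1 / a) *\<^sub>R (y - x)"
  have e: "e \<in> pts" "norm e = 1" "y = x + a *\<^sub>R e"
    using xy a by (auto simp: e_def a_def norm_minus_commute)
  obtain e' where e': "e' \<in> pts" "norm e' = 1" "e' \<bullet> e = 0"
    using exists_orthogonal_unit_pts_card[of "{e}"] e card_ge_2 by auto
  \<comment> \<open>By the law of cosines, \<open>s\<close> is the signed coordinate along
    \<open>e\<close> of the foot of the altitude from \<open>z\<close>; \<open>t\<close> below is
    the altitude. The bound on \<open>s\<close> keeps its radicand nonnegative.\<close>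
  define s where "s = (a\<^sup>2 + b\<^sup>2 - c\<^sup>2) / (2 * a)"
  have "\<bar>s\<bar> \<le> b"
  proof -
    have "(b - c)\<^sup>2 \<le> a\<^sup>2" using tri(1) a by (simp add: a_def abs_le_square_iff[symmetric])
    moreover have "c\<^sup>2 \<le> (a + b)\<^sup>2" "(a - b)\<^sup>2 \<le> c\<^sup>2"
      using tri a bc by (auto simp: a_def[symmetric] abs_le_square_iff[symmetric])
    ultimately have "- (2 * a * b) \<le> a\<^sup>2 + b\<^sup>2 - c\<^sup>2" "a\<^sup>2 + b\<^sup>2 - c\<^sup>2 \<le> 2 * a * b"
      by (simp_all add: power2_sum power2_diff)
    then show ?thesis using a by (simp add: s_def abs_le_iff field_simps)
  qed
  then have sb: "s\<^sup>2 \<le> b\<^sup>2" using abs_le_square_iff[of s b] by simp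
  have sK: "s \<in> K" using a bc by (auto simp: s_def)
  define t where "t = sqrt (b\<^sup>2 - s\<^sup>2)"
  have t: "t \<in> K" "t\<^sup>2 = b\<^sup>2 - s\<^sup>2" using sb sK bc by (auto simp: t_def)
  define z where "z = x + s *\<^sub>R e + t *\<^sub>R e'"
  have n: "norm (p *\<^sub>R e + q *\<^sub>R e') = sqrt (p\<^sup>2 + q\<^sup>2)" for p q
    unfolding norm_eq_sqrt_inner using e'(3) e'(2)[unfolded norm_eq_1] e(2)[unfolded norm_eq_1]
    by (simp add: inner_add_left inner_add_right inner_commute[of e e'] power2_eq_square)
  show ?thesis
  proof (rule that[of z])
    show "z \<in> pts" using xy e e' sK t by (auto simp: z_def)
    have "x - z = (- s) *\<^sub>R e + (- t) *\<^sub>R e'" by (simp add: z_def)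
    then show "norm (x - z) = b" using n[of "-s" "-t"] t bc by simp
    have "y - z = (a - s) *\<^sub>R e + (- t) *\<^sub>R e'" by (simp add: z_def e(3) algebra_simps)
    moreover have "(a - s)\<^sup>2 + t\<^sup>2 = c\<^sup>2"
      using a t by (simp add: power2_diff s_def)
    ultimately show "norm (y - z) = c" using n[of "a - s" "- t"] bc by simp
  qed
qed

subsection \<open>Rigid distances\<close>

definition unit_filter :: "(real ^ 'n \<Rightarrow> real ^ 'n) filter" where
  "unit_filter = (INF L\<in>{L. finite L \<and> L \<subseteq> pts}. principal {f. preserves_unit_distances L f})"

text \<open>The union of two finite sets serves both, so the principal filters form a base.
  Combining forced properties amounts to uniting their finite sets.\<close>

lemma eventually_unit_filter:
  "eventually P unit_filter \<longleftrightarrow>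
     (\<exists>L. finite L \<and> L \<subseteq> pts \<and> (\<forall>f. preserves_unit_distances L f \<longrightarrow> P f))"
proof -
  have "eventually P unit_filter \<longleftrightarrow>
    (\<exists>L\<in>{L. finite L \<and> L \<subseteq> pts}. eventually P (principal {f. preserves_unit_distances L f}))"
    unfolding unit_filter_def
  proof (rule eventually_INF_base)
    fix L M :: "(real ^ 'n) set"
    assume "L \<in> {L. finite L \<and> L \<subseteq> pts}" "M \<in> {L. finite L \<and> L \<subseteq> pts}"
    then show "\<exists>x\<in>{L. finite L \<and> L \<subseteq> pts}. principal {f. preserves_unit_distances x f}
      \<le> inf (principal {f. preserves_unit_distances L f}) (principal {f. preserves_unit_distances M f})"
      by (intro bexI[of _ "L \<union> M"]) (auto simp: preserves_unit_distances_def)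
  qed auto
  then show ?thesis by (auto simp: eventually_principal)
qed

definition rigid :: "real \<Rightarrow> bool" where
  "rigid d \<longleftrightarrow> (\<forall>x\<in>pts. \<forall>y\<in>pts. norm (x - y) = d \<longrightarrow>
     (\<forall>\<^sub>F f in unit_filter. norm (f x - f y) = d))"

lemma rigidD:
  "rigid d \<Longrightarrow> x \<in> pts \<Longrightarrow> y \<in> pts \<Longrightarrow> norm (x - y) = d \<Longrightarrow>
     \<forall>\<^sub>F f in unit_filter. norm (f x - f y) = d"
  by (simp add: rigid_def)

lemma rigid_1: "rigid 1"
  unfolding rigid_def
proof (intro ballI impI)
  fix x y :: "real ^ 'n"
  assume "x \<in> pts" "y \<in> pts" "norm (x - y) = 1"
  then show "\<forall>\<^sub>F f in unit_filter. norm (f x - f y) = 1"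
    unfolding eventually_unit_filter
    by (intro exI[of _ "{x, y}"]) (auto simp: preserves_unit_distances_def)
qed

text \<open>A path of \<open>d\<close>-steps from \<open>x\<close> to a point at distance 1 from \<open>x\<close>,
  using as few steps as possible, cannot have its first step collapsed.\<close>

lemma rigidI_zero_or:
  assumes d: "d \<in> K" "d > 0"
    and opt: "\<And>x y. x \<in> pts \<Longrightarrow> y \<in> pts \<Longrightarrow> norm (x - y) = d \<Longrightarrow>
       \<forall>\<^sub>F f in unit_filter. norm (f x - f y) = 0 \<or> norm (f x - f y) = d"
  shows "rigid d"
proof (cases "d = 1")
  case True
  then show ?thesis using rigid_1 by simp
next
  case d1: False
  show ?thesis
    unfolding rigid_def
  proof (intro ballI impI)
    fix x y :: "real ^ 'n"
    assume xy: "x \<in> pts" "y \<in> pts" "norm (x - y) = d"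
    \<comment> \<open>For \<open>d < 1\<close>, \<open>k\<close> steps stay short of length 1 and
      \<open>k + 1\<close> steps reach it, hence the rounded-up quotient minus one. For
      \<open>d > 1\<close> the path is \<open>x\<close>, \<open>y\<close>, \<open>z\<close>, an
      isosceles triangle with legs \<open>d\<close> and base 1.\<close>
    define k where "k = (if d > 1 then 1 else nat \<lceil>1 / d\<rceil> - 1)"
    have k: "k \<ge> 1" "d < 1 \<Longrightarrow> k * d < 1" "1 \<le> k * d + d" "k * d \<le> 1 + d"
    proof -
      have *: "k \<ge> 1 \<and> k * d < 1 \<and> 1 \<le> k * d + d" if "d < 1"
      proof -
        define r where "r = 1 / d"
        have "r > 1" "r * d = 1" using that d by (simp_all add: r_def)
        have "k = nat \<lceil>r\<rceil> - 1" using that by (simp add: k_def r_def)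
        then have "k \<ge> 1" "real k < r" "r \<le> real k + 1" using \<open>r > 1\<close> by linarith+
        then have "k * d < r * d" "r * d \<le> (real k + 1) * d"
          using d by (auto intro!: mult_strict_right_mono mult_right_mono)
        with \<open>k \<ge> 1\<close> \<open>r * d = 1\<close> show ?thesis by (simp add: algebra_simps)
      qed
      show "k \<ge> 1" using * d1 k_def by fastforce
      show "d < 1 \<Longrightarrow> k * d < 1" using * by blast
      show "1 \<le> k * d + d" "k * d \<le> 1 + d" using * d d1 by (cases "d < 1"; force simp: k_def)+
    qed
    define u where "u = y - x"
    have u: "u \<in> pts" "norm u = d" using xy by (auto simp: u_def norm_minus_commute)
    define w where "w j = x + real j *\<^sub>R u" for j
    have w: "w j \<in> pts" for j using xy u by (auto simp: w_def)
    have w1: "w 1 = y" by (simp add: w_def u_def)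
    have xw: "norm (x - w k) = k * d" by (simp add: w_def u)
    have "k * d > 0" using k d by simp
    have "d \<le> k * d" using k d by simp
    have "x \<noteq> w k" using xw \<open>k * d > 0\<close> by auto
    then obtain z where z: "z \<in> pts" "norm (x - z) = 1" "norm (w k - z) = d"
      using exists_triangle_pts[of x "w k" 1 d] xy w d xw k \<open>d \<le> k * d\<close> unfolding abs_le_iff
      by (smt (verit) K_1)
    have step: "norm (w j - w (Suc j)) = d" for j
      using u by (simp add: w_def algebra_simps)
    have "\<forall>\<^sub>F f in unit_filter. \<forall>j\<in>{..<k}. norm (f (w j) - f (w (Suc j))) \<le> d"
    proof (intro eventually_ball_finite ballI finite_lessThan)
      fix j
      show "\<forall>\<^sub>F f in unit_filter. norm (f (w j) - f (w (Suc j))) \<le> d"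
        using opt[OF w w step] by eventually_elim (use d in auto)
    qed
    moreover have "\<forall>\<^sub>F f in unit_filter. norm (f (w k) - f z) = 0 \<or> norm (f (w k) - f z) = d"
      by (intro opt w z)
    moreover have "\<forall>\<^sub>F f in unit_filter. norm (f x - f z) = 1"
      by (intro rigidD rigid_1 xy z)
    moreover note opt[OF xy]
    ultimately show "\<forall>\<^sub>F f in unit_filter. norm (f x - f y) = d"
    proof eventually_elim
      case (elim f)
      have "norm (f y - f (w j)) \<le> (real j - 1) * d" if "1 \<le> j" "j \<le> k" for j
        using that
      proof (induction j rule: dec_induct)
        case base
        then show ?case by (simp add: w1[symmetric])
      next
        case (step j)
        then have "norm (f (w j) - f (w (Suc j))) \<le> d" using elim(1) by auto
        then show ?case
          using step norm_triangle_ineq[of "f y - f (w j)" "f (w j) - f (w (Suc j))"]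
          by (simp add: algebra_simps)
      qed
      from this[of k] have yk: "norm (f y - f (w k)) \<le> (real k - 1) * d" using k by simp
      \<comment> \<open>If the first step collapsed, only the remaining steps would separate
        \<open>f x\<close> from \<open>f z\<close>. For \<open>d < 1\<close> these have total length
        at most \<open>k * d < 1\<close>; for \<open>d > 1\<close> the single remaining one has
        length 0 or \<open>d\<close>. Both contradict distance 1.\<close>
      show ?case
      proof (rule ccontr)
        assume "norm (f x - f y) \<noteq> d"
        then have eq: "f x = f y" using elim(4) by auto
        have le: "norm (f y - f z) \<le> norm (f y - f (w k)) + norm (f (w k) - f z)"
          using norm_triangle_ineq[of "f y - f (w k)" "f (w k) - f z"] by simp
        show False
        proof (cases "d < 1")
          case True
          have "norm (f (w k) - f z) \<le> d" using elim(2) d by auto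
          then have "norm (f y - f z) \<le> k * d" using le yk by (simp add: algebra_simps)
          then show False using k(2)[OF True] elim(3) eq by simp
        next
          case False
          then have "w k = y" using d1 w1 by (simp add: k_def)
          then show False using elim(2,3) eq d1 by auto
        qed
      qed
    qed
  qed
qed

section \<open>Rigid distances from glued simplices\<close>

lemma exists_simplex_pts:
  assumes a: "a \<in> K" "a > 0" and h: "h \<in> K" "h > 0"
    and h2: "h\<^sup>2 = b\<^sup>2 - a\<^sup>2 * (real CARD('n) - 1) / (2 * real CARD('n))"
    and xy: "x \<in> pts" "y \<in> pts" "norm (x - y) = 2 * h"
  obtains P :: "'n \<Rightarrow> real ^ 'n" where "\<And>i. P i \<in> pts"
    "\<And>i j. i \<noteq> j \<Longrightarrow> norm (P i - P j) = a"
    "\<And>r i. (norm (x + r *\<^sub>R (y - x) - P i))\<^sup>2 = b\<^sup>2 - h\<^sup>2 + ((2 * r - 1) * h)\<^sup>2"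
proof -
  define n where "n = real CARD('n)"
  define q where "q = sqrt n"
  define c where "c = a / sqrt 2"
  have n: "n > 0" "n \<in> K" by (simp_all add: n_def)
  then have q: "q > 0" "q * q = n" "q \<in> K" by (simp_all add: q_def)
  have c: "c > 0" "c * c = a\<^sup>2 / 2" "c \<in> K"
    using a by (simp_all add: c_def power2_eq_square)
  have h2': "h * h = b\<^sup>2 - c * c + c * c / n"
    using h2 n unfolding n_def[symmetric] c(2) by (simp add: power2_eq_square field_simps)
  \<comment> \<open>The points \<open>c *\<^sub>R axis i 1\<close> form a regular simplex of edge
    \<open>a\<close> with centroid \<open>(c / n) *\<^sub>R one\<close>, and \<open>one\<close>
    spans its axis. The points \<open>x0\<close>, \<open>y0\<close> lie on the axis at distance
    \<open>h\<close> on either side of the centroid; a linear isometry then moves this model to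
    \<open>x\<close>, \<open>y\<close>.\<close>
  define one :: "real ^ 'n" where "one = (\<chi> i. 1)"
  have one: "one \<in> pts" "one \<bullet> one = n" "\<And>i. one \<bullet> axis i 1 = 1"
    by (auto simp: one_def pts_def inner_axis) (simp add: n_def inner_vec_def)
  define x0 y0 where "x0 = (c / n - h / q) *\<^sub>R one" and "y0 = (c / n + h / q) *\<^sub>R one"
  have d0: "y0 - x0 = (2 * h / q) *\<^sub>R one"
    by (simp add: x0_def y0_def scaleR_diff_left[symmetric])
  have "norm one = q" using one(2) by (simp add: norm_eq_sqrt_inner q_def)
  then have "norm (y0 - x0) = norm (y - x)"
    using xy(3) h q by (simp add: d0 norm_minus_commute)
  moreover have "x0 \<in> pts" "y0 \<in> pts" using one n q c h by (auto simp: x0_def y0_def)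
  ultimately obtain R where R: "linear R" "\<And>x. norm (R x) = norm x"
      "\<And>x. x \<in> pts \<Longrightarrow> R x \<in> pts" "R (y0 - x0) = y - x"
    using exists_linear_isometry_pts[of "y0 - x0" "y - x"] xy by auto
  define P where "P i = x + R (c *\<^sub>R axis i 1 - x0)" for i
  have axis_diff: "norm (axis i 1 - axis j 1 :: real ^ 'n) = sqrt 2" if "i \<noteq> j" for i j
    using that by (simp add: norm_eq_sqrt_inner inner_diff_left inner_diff_right inner_axis_axis)
  show ?thesis
  proof (rule that[of P])
    show "P i \<in> pts" for i
      unfolding P_def using xy c \<open>x0 \<in> pts\<close> by (intro pts_add R pts_diff pts_scaleR) auto
    show "norm (P i - P j) = a" if "i \<noteq> j" for i j
    proof -
      have "P i - P j = R (c *\<^sub>R axis i 1 - x0 - (c *\<^sub>R axis j 1 - x0))"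
        unfolding P_def linear_diff[OF R(1)] by simp
      then have "norm (P i - P j) = norm (c *\<^sub>R (axis i 1 - axis j 1) :: real ^ 'n)"
        by (simp add: R(2) scaleR_diff_right)
      also have "\<dots> = c * sqrt 2"
        using c(1) axis_diff[OF that] by simp
      also have "\<dots> = a"
        by (simp add: c_def)
      finally show ?thesis .
    qed
    show "(norm (x + r *\<^sub>R (y - x) - P i))\<^sup>2 = b\<^sup>2 - h\<^sup>2 + ((2 * r - 1) * h)\<^sup>2" for r i
    proof -
      define t where "t = (2 * r - 1) * h / q"
      have tt: "t * t * n = ((2 * r - 1) * h)\<^sup>2"
        unfolding q(2)[symmetric] using q(1) by (simp add: t_def power2_eq_square)
      have "x + r *\<^sub>R (y - x) - P i = R (r *\<^sub>R (y0 - x0) - (c *\<^sub>R axis i 1 - x0))"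
        unfolding P_def linear_diff[OF R(1), of "r *\<^sub>R (y0 - x0)"] linear_cmul[OF R(1)] R(4) by simp
      moreover have "r *\<^sub>R (y0 - x0) - (c *\<^sub>R axis i 1 - x0) = (c / n + t) *\<^sub>R one - c *\<^sub>R axis i 1"
        unfolding d0 by (simp add: x0_def t_def algebra_simps diff_divide_distrib)
      ultimately have "(norm (x + r *\<^sub>R (y - x) - P i))\<^sup>2
          = (norm ((c / n + t) *\<^sub>R one - c *\<^sub>R axis i 1))\<^sup>2"
        by (simp only: R(2))
      also have "\<dots> = (c / n + t) * (c / n + t) * n - 2 * c * (c / n + t) + c * c"
        unfolding dot_square_norm[symmetric]
        by (simp add: inner_diff_left inner_diff_right one inner_commute[of "axis i 1" one] inner_axis_axis algebra_simps)
      also have "\<dots> = c * c - c * c / n + t * t * n"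
        using n by (simp add: field_simps)
      also have "\<dots> = b\<^sup>2 - h\<^sup>2 + ((2 * r - 1) * h)\<^sup>2"
        using h2' tt by (simp add: power2_eq_square)
      finally show ?thesis .
    qed
  qed
qed

lemma eventually_rigid_family:
  assumes "rigid d" "\<And>i. P i \<in> pts" "\<And>i j. i \<noteq> j \<Longrightarrow> norm (P i - P j) = d"
  shows "\<forall>\<^sub>F f in unit_filter. \<forall>i j :: 'n. i \<noteq> j \<longrightarrow> norm (f (P i) - f (P j)) = d"
proof (intro eventually_all_finite)
  fix i j :: 'n
  show "\<forall>\<^sub>F f in unit_filter. i \<noteq> j \<longrightarrow> norm (f (P i) - f (P j)) = d"
    using rigidD[OF assms(1) assms(2) assms(2) assms(3)] by (cases "i = j") auto
qed

lemma eventually_rigid_star: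
  assumes "rigid d" "\<And>i. P i \<in> pts" "x \<in> pts" "\<And>i. norm (x - P i) = d"
  shows "\<forall>\<^sub>F f in unit_filter. \<forall>i :: 'n. norm (f x - f (P i)) = d"
proof (rule eventually_all_finite)
  show "\<forall>\<^sub>F f in unit_filter. norm (f x - f (P i)) = d" for i
    by (rule rigidD) (use assms in auto)
qed

text \<open>\<open>x\<close> and \<open>y\<close> are the apexes on both sides of a simplex with
  edges \<open>a\<close>. Its image is congruent to it, so the images of the apexes coincide or are
  mirror images; \<open>rigidI_zero_or\<close> excludes the collapse.\<close>

lemma rigid_double_height:
  assumes a: "rigid a" "a \<in> K" "a > 0" and b: "rigid b" "b \<ge> 0" and h: "h \<in> K" "h > 0"
    and h2: "h\<^sup>2 = b\<^sup>2 - a\<^sup>2 * (real CARD('n) - 1) / (2 * real CARD('n))"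
  shows "rigid (2 * h)"
proof (rule rigidI_zero_or)
  fix x y :: "real ^ 'n"
  assume xy: "x \<in> pts" "y \<in> pts" "norm (x - y) = 2 * h"
  obtain P :: "'n \<Rightarrow> real ^ 'n" where P: "\<And>i. P i \<in> pts"
      "\<And>i j. i \<noteq> j \<Longrightarrow> norm (P i - P j) = a"
      "\<And>r i. (norm (x + r *\<^sub>R (y - x) - P i))\<^sup>2 = b\<^sup>2 - h\<^sup>2 + ((2 * r - 1) * h)\<^sup>2"
    using exists_simplex_pts[OF a(2,3) h h2 xy] by blast
  have "(norm (x - P i))\<^sup>2 = b\<^sup>2" "(norm (y - P i))\<^sup>2 = b\<^sup>2" for i
    using P(3)[of 0 i] P(3)[of 1 i] by simp_all
  then have xyP: "norm (x - P i) = b" "norm (y - P i) = b" for i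
    using b(2) by (auto intro: power2_eq_imp_eq)
  have dist: "\<forall>\<^sub>F f in unit_filter. \<forall>i. norm (f v - f (P i)) = b" if "v \<in> {x, y}" for v
    by (rule eventually_rigid_star) (use that b P xy xyP in auto)
  have "\<forall>\<^sub>F f in unit_filter. \<forall>i j. i \<noteq> j \<longrightarrow> norm (f (P i) - f (P j)) = a"
    using a P by (intro eventually_rigid_family) auto
  with dist[OF insertI1] dist[OF insertI2[OF insertI1]] show "\<forall>\<^sub>F f in unit_filter. norm (f x - f y) = 0 \<or> norm (f x - f y) = 2 * h"
  proof eventually_elim
    case (elim f)
    show ?case
      using regular_simplex_equidistant[OF a(3) h(2) h2, of "\<lambda>i. f (P i)" "f x" "f y"] elim by simp
  qed
qed (use h in auto)

text \<open>Twice the inradius of the regular simplex inscribed in the unit sphere: the distance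
  from its centre to the mirror image of the centre in a facet.\<close>

definition \<delta> :: real where "\<delta> = 2 / real CARD('n)"

lemma \<delta>_pos: "\<delta> > 0" and \<delta>_K [simp]: "\<delta> \<in> K"
  by (simp_all add: \<delta>_def)

text \<open>Two regular simplices of edge 1 are glued along a facet; \<open>h\<close> is their
  height.\<close>

lemma rigid_simplex_reflection: "rigid (sqrt (2 + \<delta>))"
proof -
  define n where "n = real CARD('n)"
  have n: "n > 0" by (simp add: n_def)
  define h where "h = sqrt (2 + \<delta>) / 2"
  have "h\<^sup>2 = (2 + \<delta>) / 4"
    using \<delta>_pos by (simp add: h_def power_divide)
  also have "\<dots> = 1\<^sup>2 - 1\<^sup>2 * (real CARD('n) - 1) / (2 * real CARD('n))"
    using n unfolding \<delta>_def n_def[symmetric] by (simp add: field_simps)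
  finally have "rigid (2 * h)"
    using \<delta>_pos by (intro rigid_double_height[OF rigid_1 _ _ rigid_1]) (auto simp: h_def)
  then show ?thesis by (simp add: h_def)
qed

text \<open>The simplex with edge \<open>sqrt (2 + \<delta>)\<close> is the one inscribed in the
  unit sphere, so its centre has height \<open>1 / n = \<delta> / 2\<close> over each facet.\<close>

lemma height_\<delta>:
  "(\<delta> / 2)\<^sup>2 = 1\<^sup>2 - (sqrt (2 + \<delta>))\<^sup>2 * (real CARD('n) - 1) / (2 * real CARD('n))"
proof -
  define n where "n = real CARD('n)"
  have n: "n > 0" by (simp add: n_def)
  have "(sqrt (2 + \<delta>))\<^sup>2 = 2 + \<delta>" using \<delta>_pos by simp
  then show ?thesis
    using n unfolding \<delta>_def n_def[symmetric] by (simp add: field_simps power2_eq_square)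
qed

lemma rigid_\<delta>: "rigid \<delta>"
  using rigid_double_height[OF rigid_simplex_reflection _ _ rigid_1 _ _ _ height_\<delta>] \<delta>_pos
  by auto

text \<open>\<open>p\<close> and the \<open>P i\<close> are the vertices of the inscribed simplex,
  \<open>z\<close> is its centre and \<open>y\<close> the mirror image of the centre in the facet
  opposite \<open>p\<close>. All distances involved are rigid, so the image is such a configuration
  again.\<close>

lemma eventually_collinear_1_\<delta>:
  assumes p: "p \<in> pts" and u: "u \<in> pts" "norm u = 1"
  shows "\<forall>\<^sub>F f in unit_filter.
    f (p + (1 + \<delta>) *\<^sub>R u) - f (p + u) = \<delta> *\<^sub>R (f (p + u) - f p)"
proof -
  define l where "l = sqrt (2 + \<delta>)"
  have l: "rigid l" "l > 0" "l \<in> K"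
    using rigid_simplex_reflection \<delta>_pos by (auto simp: l_def)
  define z y where "z = p + u" and "y = p + (1 + \<delta>) *\<^sub>R u"
  have pts: "z \<in> pts" "y \<in> pts" using assms by (auto simp: z_def y_def)
  have yz: "y - z = \<delta> *\<^sub>R u" by (simp add: y_def z_def algebra_simps)
  have "norm (z - y) = 2 * (\<delta> / 2)" using yz u \<delta>_pos by (simp add: norm_minus_commute)
  then obtain P :: "'n \<Rightarrow> real ^ 'n" where P: "\<And>i. P i \<in> pts"
      "\<And>i j. i \<noteq> j \<Longrightarrow> norm (P i - P j) = l"
      "\<And>r i. (norm (z + r *\<^sub>R (y - z) - P i))\<^sup>2 = 1\<^sup>2 - (\<delta> / 2)\<^sup>2 + ((2 * r - 1) * (\<delta> / 2))\<^sup>2"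
    using exists_simplex_pts[OF l(3,2) _ _ height_\<delta>[folded l_def] pts] \<delta>_pos by auto
  have zy: "norm (z - P i) = 1" "norm (y - P i) = 1" for i
    using P(3)[of 0 i] P(3)[of 1 i]
      power2_eq_imp_eq[of "norm (z - P i)" 1] power2_eq_imp_eq[of "norm (y - P i)" 1] by simp_all
  have pP: "norm (p - P i) = l" for i
  proof -
    \<comment> \<open>The vertex \<open>p\<close> lies on the axis of the facet at distance 1 from
      \<open>z\<close>, on the side away from \<open>y\<close>, whence the parameter
      \<open>- (1 / \<delta>)\<close>.\<close>
    have "z + (- (1 / \<delta>)) *\<^sub>R (y - z) = p" using \<delta>_pos by (simp add: yz) (simp add: z_def)
    then have "(norm (p - P i))\<^sup>2 = 1\<^sup>2 - (\<delta> / 2)\<^sup>2 + ((2 * (- (1 / \<delta>)) - 1) * (\<delta> / 2))\<^sup>2"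
      using P(3)[of "- (1 / \<delta>)" i] by simp
    also have "\<dots> = l\<^sup>2" using \<delta>_pos by (simp add: l_def field_simps power2_eq_square)
    finally show ?thesis using l by (simp add: power2_eq_imp_eq)
  qed
  have "\<forall>\<^sub>F f in unit_filter. \<forall>i. norm (f p - f (P i)) = l"
    by (rule eventually_rigid_star) (use l P p pP in auto)
  moreover have "\<forall>\<^sub>F f in unit_filter. \<forall>i. norm (f z - f (P i)) = 1"
    by (rule eventually_rigid_star) (use rigid_1 P pts zy in auto)
  moreover have "\<forall>\<^sub>F f in unit_filter. \<forall>i. norm (f y - f (P i)) = 1"
    by (rule eventually_rigid_star) (use rigid_1 P pts zy in auto)
  moreover have "\<forall>\<^sub>F f in unit_filter. norm (f z - f p) = 1"
    using u p by (intro rigidD rigid_1 pts) (simp_all add: z_def)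
  moreover have "\<forall>\<^sub>F f in unit_filter. norm (f y - f z) = \<delta>"
    using u yz \<delta>_pos by (intro rigidD rigid_\<delta> pts) simp
  moreover have "\<forall>\<^sub>F f in unit_filter. \<forall>i j. i \<noteq> j \<longrightarrow> norm (f (P i) - f (P j)) = l"
    using l P by (intro eventually_rigid_family) auto
  ultimately show ?thesis
  proof eventually_elim
    case (elim f)
    then show ?case
      using regular_simplex_reflected_centre[of "\<lambda>i. f (P i)" "f p" "f z" "f y"]
      unfolding l_def z_def y_def \<delta>_def by simp
  qed
qed

text \<open>Ratios \<open>1 : \<delta>\<close> become equal steps by elimination between overlapping
  collinear triples: one triple read forward, two read backward along the same line.\<close>

lemma eventually_arith_step:
  assumes p: "p \<in> pts" and u: "u \<in> pts" "norm u = 1"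
  shows "\<forall>\<^sub>F f in unit_filter.
    f (p + (2 * \<delta>) *\<^sub>R u) - f (p + \<delta> *\<^sub>R u) = f (p + \<delta> *\<^sub>R u) - f p"
proof -
  define g where "g s = p + s *\<^sub>R u" for s
  have g: "g s \<in> pts" if "s \<in> K" for s using that assms by (simp add: g_def)
  have fwd: "\<forall>\<^sub>F f in unit_filter.
      f (g (s + 1 + \<delta>)) - f (g (s + 1)) = \<delta> *\<^sub>R (f (g (s + 1)) - f (g s))" if "s \<in> K" for s
    using eventually_collinear_1_\<delta>[OF g[OF that] u] by (simp add: g_def algebra_simps)
  have bwd: "\<forall>\<^sub>F f in unit_filter.
      f (g (s + \<delta>)) - f (g s) = \<delta> *\<^sub>R (f (g (s + 1 + \<delta>)) - f (g (s + \<delta>)))" if "s \<in> K" for s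
  proof -
    have "g (s + 1 + \<delta>) \<in> pts" "- u \<in> pts" "norm (- u) = 1" using that u g by simp_all
    from eventually_collinear_1_\<delta>[OF this] show ?thesis
      by eventually_elim (simp add: g_def algebra_simps)
  qed
  show ?thesis
    using fwd[OF \<delta>_K] bwd[OF K_0] bwd[OF \<delta>_K]
  proof eventually_elim
    case (elim f)
    define P Q R S where "P = f (g \<delta>)" and "Q = f (g (2 * \<delta>))"
      and "R = f (g (1 + \<delta>))" and "S = f (g (1 + 2 * \<delta>))"
    have 1: "S - R = \<delta> *\<^sub>R (R - P)" and 2: "Q - P = \<delta> *\<^sub>R (S - Q)" and 3: "P - f (g 0) = \<delta> *\<^sub>R (R - P)"
      using elim by (simp_all add: P_def Q_def R_def S_def algebra_simps)
    have "(1 + \<delta>) *\<^sub>R (Q - P) = \<delta> *\<^sub>R (S - P)"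
      using 2 by (simp add: algebra_simps)
    also have "\<dots> = \<delta> *\<^sub>R ((S - R) + (R - P))" by simp
    also have "\<dots> = (1 + \<delta>) *\<^sub>R (\<delta> *\<^sub>R (R - P))"
      unfolding 1 by (simp add: algebra_simps)
    finally have "Q - P = \<delta> *\<^sub>R (R - P)"
      unfolding scaleR_cancel_left using \<delta>_pos by simp
    then have "Q - P = P - f (g 0)" by (simp add: 3)
    then show ?case by (simp add: P_def Q_def g_def)
  qed
qed

lemma eventually_arith_progression:
  assumes p: "p \<in> pts" and u: "u \<in> pts" "norm u = 1"
  shows "\<forall>\<^sub>F f in unit_filter.
    f (p + (real k * \<delta>) *\<^sub>R u) - f p = real k *\<^sub>R (f (p + \<delta> *\<^sub>R u) - f p)"
proof -
  have "\<forall>\<^sub>F f in unit_filter.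
    f (p + (real (Suc k) * \<delta>) *\<^sub>R u) - f (p + (real k * \<delta>) *\<^sub>R u) = f (p + \<delta> *\<^sub>R u) - f p" for k
  proof (induction k)
    case (Suc k)
    have "p + (real k * \<delta>) *\<^sub>R u \<in> pts" using p u by simp
    have eq: "p + (real k * \<delta>) *\<^sub>R u + (2 * \<delta>) *\<^sub>R u = p + (real (Suc (Suc k)) * \<delta>) *\<^sub>R u"
      "p + (real k * \<delta>) *\<^sub>R u + \<delta> *\<^sub>R u = p + (real (Suc k) * \<delta>) *\<^sub>R u"
      by (simp_all add: add.assoc scaleR_left_distrib[symmetric]) (simp_all add: algebra_simps)
    from eventually_arith_step[OF \<open>p + _ \<in> pts\<close> u] Suc show ?case
      unfolding eq by eventually_elim simp
  qed simp
  note step = this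
  show ?thesis
  proof (induction k)
    case (Suc k)
    from this step[of k] show ?case
    proof eventually_elim
      case (elim f)
      have "f (p + (real (Suc k) * \<delta>) *\<^sub>R u) - f p
          = (f (p + (real (Suc k) * \<delta>) *\<^sub>R u) - f (p + (real k * \<delta>) *\<^sub>R u))
            + (f (p + (real k * \<delta>) *\<^sub>R u) - f p)"
        by simp
      then show ?case
        unfolding elim by (simp add: scaleR_left_distrib)
    qed
  qed simp
qed

text \<open>Similar isosceles triangles with a common apex: the images of both legs are divided
  in the ratio \<open>k : m\<close>, so the intercept theorem applies to the image.\<close>

lemma rigid_ratio:
  assumes "k > 0" "m > 0"
  shows "rigid (real k / real m * \<delta>)"
  unfolding rigid_def
proof (intro ballI impI)
  fix x y :: "real ^ 'n"
  assume xy: "x \<in> pts" "y \<in> pts" and d: "norm (x - y) = real k / real m * \<delta>"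
  define r where "r = real k * \<delta>"
  have r: "r > 0" "r \<in> K" using assms \<delta>_pos by (auto simp: r_def)
  have "norm (x - y) \<le> r + r"
  proof -
    have "real k / real m \<le> real k" using assms by (simp add: field_simps)
    then have "norm (x - y) \<le> r" unfolding d r_def using \<delta>_pos by (intro mult_right_mono) auto
    then show ?thesis using r by simp
  qed
  moreover have "x \<noteq> y" using d assms \<delta>_pos by auto
  ultimately obtain c where c: "c \<in> pts" "norm (x - c) = r" "norm (y - c) = r"
    using exists_triangle_pts[of x y r r] xy r by auto
  define u v where "u = (1 / r) *\<^sub>R (x - c)" and "v = (1 / r) *\<^sub>R (y - c)"
  have uv: "u \<in> pts" "norm u = 1" "v \<in> pts" "norm v = 1"
    using xy c r by (auto simp: u_def v_def)
  have xu: "x = c + (real k * \<delta>) *\<^sub>R u" and yv: "y = c + (real k * \<delta>) *\<^sub>R v"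
    using r by (simp_all add: u_def v_def r_def[symmetric])
  \<comment> \<open>Points \<open>m\<close> steps from the apex \<open>c\<close> on the lines of the
    two legs: by similarity their distance is \<open>\<delta>\<close>, already known to be
    rigid.\<close>
  define A B where "A = c + (real m * \<delta>) *\<^sub>R u" and "B = c + (real m * \<delta>) *\<^sub>R v"
  have AB: "A \<in> pts" "B \<in> pts" using c uv by (auto simp: A_def B_def)
  have "A - B = (real m / real k) *\<^sub>R (x - y)"
    unfolding A_def B_def xu yv using assms by (simp add: algebra_simps)
  then have "norm (A - B) = \<delta>" using d assms \<delta>_pos by simp
  then have "\<forall>\<^sub>F f in unit_filter. norm (f A - f B) = \<delta>" by (intro rigidD rigid_\<delta> AB)
  with eventually_arith_progression[OF c(1) uv(1,2), of k]
    eventually_arith_progression[OF c(1) uv(1,2), of m]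
    eventually_arith_progression[OF c(1) uv(3,4), of k]
    eventually_arith_progression[OF c(1) uv(3,4), of m]
  show "\<forall>\<^sub>F f in unit_filter. norm (f x - f y) = real k / real m * \<delta>"
    unfolding xu[symmetric] yv[symmetric] A_def[symmetric] B_def[symmetric]
  proof eventually_elim
    case (elim f)
    define a b where "a = f (c + \<delta> *\<^sub>R u) - f c" and "b = f (c + \<delta> *\<^sub>R v) - f c"
    have "f x - f y = (f x - f c) - (f y - f c)" "f A - f B = (f A - f c) - (f B - f c)"
      by simp_all
    then have "f x - f y = real k *\<^sub>R (a - b)" "f A - f B = real m *\<^sub>R (a - b)"
      unfolding elim(1-4) by (simp_all add: a_def b_def scaleR_diff_right)
    then have "norm (f x - f y) = real k * norm (a - b)" "real m * norm (a - b) = \<delta>"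
      using elim(5) by simp_all
    then show ?case using assms(2) by (auto simp: field_simps)
  qed
qed

text \<open>\<open>\<delta>\<close> is itself rational, so every positive rational is a ratio
  \<open>k / m\<close> times \<open>\<delta>\<close>.\<close>

lemma rigid_Rats:
  assumes "r \<in> \<rat>" "r > 0"
  shows "rigid r"
proof -
  have "r / \<delta> \<in> \<rat>" "r / \<delta> > 0" using assms \<delta>_pos by (auto simp: \<delta>_def)
  then obtain k m :: nat where km: "m \<noteq> 0" "\<bar>r / \<delta>\<bar> = real k / real m"
    by (elim Rats_abs_nat_div_natE)
  then have eq: "r = real k / real m * \<delta>" using \<open>r / \<delta> > 0\<close> \<delta>_pos by (simp add: field_simps)
  then have "k > 0" using assms by (cases "k = 0") auto
  then show ?thesis unfolding eq using km by (intro rigid_ratio) auto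
qed

lemma Rats_K: "r \<in> \<rat> \<Longrightarrow> r \<in> K"
proof -
  assume "r \<in> \<rat>"
  then obtain k m :: nat where "\<bar>r\<bar> = real k / real m" by (elim Rats_abs_nat_div_natE)
  then have "\<bar>r\<bar> \<in> K" by simp
  then show ?thesis by (cases "r \<ge> 0") (use K_uminus[of "- r"] in auto)
qed

text \<open>A point \<open>z\<close> with two different rational distances to \<open>x\<close> and
  \<open>y\<close> keeps both, so the images cannot coincide; \<open>e < a < r\<close> secures the
  triangle inequalities.\<close>

lemma eventually_neq:
  assumes xy: "x \<in> pts" "y \<in> pts" "x \<noteq> y"
  shows "\<forall>\<^sub>F f in unit_filter. f x \<noteq> f y"
proof -
  define a where "a = norm (x - y)"
  have a: "a > 0" using xy by (simp add: a_def)
  obtain e where e: "e \<in> \<rat>" "0 < e" "e < a" using Rats_dense_in_real[OF a] by blast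
  obtain r where r: "r \<in> \<rat>" "a < r" "r < a + 1" using Rats_dense_in_real[of a "a + 1"] by auto
  obtain z where z: "z \<in> pts" "norm (x - z) = r" "norm (y - z) = r + e"
    using exists_triangle_pts[of x y r "r + e"] xy e r a Rats_K
    unfolding a_def[symmetric] by (auto simp: abs_le_iff)
  have "\<forall>\<^sub>F f in unit_filter. norm (f x - f z) = r"
    "\<forall>\<^sub>F f in unit_filter. norm (f y - f z) = r + e"
    using e r a by (intro rigidD rigid_Rats xy z; simp)+
  then show ?thesis by eventually_elim (use e in auto)
qed

subsection \<open>Transport along a hyperplane\<close>

lemma eventually_rectangle:
  assumes p: "p \<in> pts" and u: "u \<in> pts" "norm u = 3" and w: "w \<in> pts" "norm w = 4"
    and uw: "u \<bullet> w = 0"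
  shows "\<forall>\<^sub>F f in unit_filter. f (p + u + w) - f (p + u) = f (p + w) - f p \<and>
    (f (p + u) - f p) \<bullet> (f (p + w) - f p) = 0"
proof -
  have "u \<bullet> u = 9" "w \<bullet> w = 16" using u(2) w(2) by (simp_all add: dot_square_norm)
  then have "norm (u - w) = 5" "norm (u + w) = 5"
    using uw unfolding norm_eq_sqrt_inner
    by (simp_all add: inner_diff_left inner_diff_right inner_add_left inner_add_right inner_commute)
  then have "\<forall>\<^sub>F f in unit_filter. norm (f (p + u) - f p) = 3"
    "\<forall>\<^sub>F f in unit_filter. norm (f (p + w) - f p) = 4"
    "\<forall>\<^sub>F f in unit_filter. norm (f (p + u) - f (p + w)) = 5"
    "\<forall>\<^sub>F f in unit_filter. norm (f (p + u + w) - f p) = 5"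
    "\<forall>\<^sub>F f in unit_filter. norm (f (p + u + w) - f (p + u)) = 4"
    "\<forall>\<^sub>F f in unit_filter. norm (f (p + u + w) - f (p + w)) = 3"
    using p u w by (auto intro!: rigidD rigid_Rats simp: algebra_simps)
  then show ?thesis
  proof eventually_elim
    case (elim f)
    then show ?case
      using rectangle_3_4_5[of "f (p + u)" "f p" "f (p + w)" "f (p + u + w)"] by simp
  qed
qed

text \<open>\<open>y - x\<close> is cut into short pieces \<open>s\<close>, each the sum of two
  steps \<open>u\<close>, \<open>v\<close> of length 3 orthogonal to \<open>w\<close>. Their
  construction takes a direction \<open>e\<close> orthogonal to both \<open>s\<close> and
  \<open>w\<close>, which is where a dimension above 2 enters.\<close>

lemma eventually_orthogonal_transport:
  assumes card: "CARD('n) > 2" and w: "w \<in> pts" "norm w = 4"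
    and xy: "x \<in> pts" "y \<in> pts" "(y - x) \<bullet> w = 0"
  shows "\<forall>\<^sub>F f in unit_filter. f (y + w) - f y = f (x + w) - f x \<and>
    (f y - f x) \<bullet> (f (x + w) - f x) = 0"
proof -
  define N where "N = Suc (nat \<lceil>norm (y - x)\<rceil>)"
  have N: "real N > 0" by (simp only: N_def of_nat_0_less_iff zero_less_Suc)
  define s where "s = (1 / real N) *\<^sub>R (y - x)"
  have s: "s \<in> pts" "s \<bullet> w = 0" using xy unfolding s_def by (auto intro!: pts_scaleR)
  have ys: "y = x + real N *\<^sub>R s" using N by (simp add: s_def divide_le_eq)
  have "norm (y - x) \<le> real N" unfolding N_def by linarith
  then have "norm s \<le> 1" using N by (simp add: s_def divide_le_eq)
  then have s1: "(norm s)\<^sup>2 \<le> 1" by (simp add: abs_square_le_1)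
  obtain e where e: "e \<in> pts" "norm e = 1" "\<And>z. z \<in> {s, w} \<Longrightarrow> e \<bullet> z = 0"
  proof (rule exists_orthogonal_unit_pts_card[of "{s, w}"])
    show "card {s, w} < CARD('n)" using card card_insert_le_m1[of 2 "{w}" s] by simp
  qed (use s w in auto)
  \<comment> \<open>Chosen so that half of \<open>s\<close> and \<open>t *\<^sub>R e\<close> are the
    legs of a right triangle with hypotenuse 3.\<close>
  define t where "t = sqrt (9 - (norm s)\<^sup>2 / 4)"
  have t: "t \<in> K" "t * t = 9 - (norm s)\<^sup>2 / 4" using s s1 by (auto simp: t_def)
  define u v where "u = (1 / 2) *\<^sub>R s + t *\<^sub>R e" and "v = (1 / 2) *\<^sub>R s - t *\<^sub>R e"
  have uv: "u \<in> pts" "v \<in> pts" using s e t by (auto simp: u_def v_def)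
  have orth: "u \<bullet> w = 0" "v \<bullet> w = 0" using s e by (simp_all add: u_def v_def inner_add_left inner_diff_left)
  have "e \<bullet> e = 1" "s \<bullet> e = 0" "e \<bullet> s = 0"
    using e(2) e(3)[of s] by (simp_all add: norm_eq_1 inner_commute[of s])
  then have "u \<bullet> u = 9" "v \<bullet> v = 9"
    using t(2) unfolding power2_norm_eq_inner by (simp_all add: u_def v_def inner_add_left
        inner_add_right inner_diff_left inner_diff_right)
  then have norms: "norm u = 3" "norm v = 3" by (simp_all add: norm_eq_sqrt_inner)
  have suv: "s = u + v" by (simp add: u_def v_def scaleR_left_distrib[symmetric])
  have "\<forall>\<^sub>F f in unit_filter.
      f (x + real k *\<^sub>R s + w) - f (x + real k *\<^sub>R s) = f (x + w) - f x \<and>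
      (f (x + real k *\<^sub>R s) - f x) \<bullet> (f (x + w) - f x) = 0" for k
  proof (induction k)
    case (Suc k)
    define z where "z = x + real k *\<^sub>R s"
    have z: "z \<in> pts" "z + u \<in> pts" using xy s uv by (auto simp: z_def)
    have eq: "x + real (Suc k) *\<^sub>R s = z + u + v"
      by (simp add: z_def suv scaleR_left_distrib add_ac)
    from Suc[folded z_def] eventually_rectangle[OF z(1) uv(1) norms(1) w orth(1)]
      eventually_rectangle[OF z(2) uv(2) norms(2) w orth(2)]
    show ?case
      unfolding eq
    proof eventually_elim
      case (elim f)
      have "(f (z + u + v) - f x) \<bullet> q
          = (f (z + u + v) - f (z + u)) \<bullet> q + (f (z + u) - f z) \<bullet> q + (f z - f x) \<bullet> q" for q
        by (simp add: inner_diff_left)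
      then show ?case using elim by simp
    qed
  qed simp
  from this[of N] show ?thesis by (simp add: ys)
qed

subsection \<open>The plane\<close>

text \<open>Every point over \<open>K\<close> is a sum of unit vectors over \<open>K\<close>: it is
  a natural multiple of a vector \<open>s\<close> of length at most 1, and an isosceles triangle
  with unit legs splits \<open>s\<close>.\<close>

lemma pts_unit_induct [consumes 1, case_names unit add]:
  assumes "x \<in> pts"
    and unit: "\<And>u. u \<in> pts \<Longrightarrow> norm u = 1 \<Longrightarrow> Q u"
    and add: "\<And>u v. u \<in> pts \<Longrightarrow> v \<in> pts \<Longrightarrow> Q u \<Longrightarrow> Q v \<Longrightarrow> Q (u + v)"
  shows "Q x"
proof -
  have zero: "Q 0"
    using add[of "axis undefined 1" "- axis undefined 1"] unit by simp
  define N where "N = Suc (nat \<lceil>norm x\<rceil>)"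
  have N: "real N > 0" by (simp only: N_def of_nat_0_less_iff zero_less_Suc)
  define s where "s = (1 / real N) *\<^sub>R x"
  have s: "s \<in> pts" using assms(1) unfolding s_def by (auto intro!: pts_scaleR)
  have xs: "x = real N *\<^sub>R s" using N by (simp add: s_def divide_le_eq)
  have "norm x \<le> real N" unfolding N_def by linarith
  then have s1: "norm s \<le> 1" using N by (simp add: s_def divide_le_eq)
  have "Q s"
  proof (cases "s = 0")
    case False
    then obtain z where z: "z \<in> pts" "norm (0 - z) = 1" "norm (s - z) = 1"
      using exists_triangle_pts[of 0 s 1 1] s s1 by auto
    then show ?thesis using add[of z "s - z"] unit[of z] unit[of "s - z"] s by simp
  qed (use zero in simp)
  have "Q (real k *\<^sub>R s)" for k
  proof (induction k)
    case (Suc k)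
    then show ?case using add[of s "real k *\<^sub>R s"] \<open>Q s\<close> s by (simp add: scaleR_left_distrib)
  qed (use zero in simp)
  then show ?thesis by (simp add: xs)
qed

text \<open>Unit rhombi go to unit rhombi, and \<open>eventually_neq\<close> keeps the images
  unfolded. This gives the claim for unit \<open>w\<close> and \<open>v\<close>; induction over sums
  of unit vectors extends it first in \<open>w\<close>, then in \<open>v\<close>.\<close>

lemma eventually_translation:
  assumes card: "CARD('n) = 2" and "p \<in> pts" "w \<in> pts" "v \<in> pts"
  shows "\<forall>\<^sub>F f in unit_filter. f (p + w + v) - f (p + w) = f (p + v) - f p"
proof -
  have rhombus: "\<forall>\<^sub>F f in unit_filter. f (p + u + v) - f (p + u) = f (p + v) - f p"
    if "p \<in> pts" "u \<in> pts" "norm u = 1" "v \<in> pts" "norm v = 1" "u \<noteq> v" "u \<noteq> - v" for p u v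
  proof -
    have "p \<noteq> p + u + v" using that(7) by (simp add: add.assoc eq_neg_iff_add_eq_0)
    moreover have "p + u \<noteq> p + v" using that(6) by simp
    ultimately have "\<forall>\<^sub>F f in unit_filter. f p \<noteq> f (p + u + v)"
      "\<forall>\<^sub>F f in unit_filter. f (p + u) \<noteq> f (p + v)"
      using that by (auto intro!: eventually_neq)
    moreover have "\<forall>\<^sub>F f in unit_filter. norm (f (p + u) - f p) = 1"
      "\<forall>\<^sub>F f in unit_filter. norm (f (p + v) - f p) = 1"
      "\<forall>\<^sub>F f in unit_filter. norm (f (p + u + v) - f (p + u)) = 1"
      "\<forall>\<^sub>F f in unit_filter. norm (f (p + u + v) - f (p + v)) = 1"
      using that by (auto intro!: rigidD rigid_1)
    ultimately show ?thesis
      by eventually_elim (rule rhombus_of_unit_sides[OF card])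
  qed
  have unit: "\<forall>\<^sub>F f in unit_filter. f (p + u + v) - f (p + u) = f (p + v) - f p"
    if asm: "p \<in> pts" "u \<in> pts" "norm u = 1" "v \<in> pts" "norm v = 1" for p u v
  proof (cases "u = v \<or> u = - v")
    case True
    \<comment> \<open>For \<open>u = v\<close> or \<open>u = - v\<close> the rhombus degenerates, so
      the translation by \<open>u\<close> is made in two unit steps \<open>z\<close> and
      \<open>u - z\<close>, neither parallel to \<open>v\<close>.\<close>
    have "u \<noteq> 0" using asm by auto
    then obtain z where z: "z \<in> pts" "norm (0 - z) = 1" "norm (u - z) = 1"
      using exists_triangle_pts[of 0 u 1 1] asm by auto
    have ne: "z \<noteq> u" "z \<noteq> - u" "u - z \<noteq> u" "u - z \<noteq> - u"
    proof -
      show "z \<noteq> u" using z(3) by auto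
      show "z \<noteq> - u"
      proof
        assume "z = - u"
        then have "u - z = 2 *\<^sub>R u" by (simp add: scaleR_2)
        then show False using z(3) asm(3) by simp
      qed
      show "u - z \<noteq> u" using z(2) by auto
      show "u - z \<noteq> - u"
      proof
        assume "u - z = - u"
        then have "z = 2 *\<^sub>R u" by (simp add: scaleR_2 algebra_simps)
        then show False using z(2) asm(3) by simp
      qed
    qed
    have "\<forall>\<^sub>F f in unit_filter. f (p + z + v) - f (p + z) = f (p + v) - f p"
      using ne z asm True by (intro rhombus) auto
    moreover have "\<forall>\<^sub>F f in unit_filter.
        f (p + z + (u - z) + v) - f (p + z + (u - z)) = f (p + z + v) - f (p + z)"
      using ne z asm True by (intro rhombus) auto
    ultimately show ?thesis by eventually_elim simp
  qed (use rhombus asm in blast)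
  have "\<forall>p\<in>pts. \<forall>\<^sub>F f in unit_filter. f (p + w + v) - f (p + w) = f (p + v) - f p"
    if "v \<in> pts" "norm v = 1" for v
    using \<open>w \<in> pts\<close>
  proof (induction w rule: pts_unit_induct)
    case (add u w)
    show ?case
    proof
      fix p assume p: "p \<in> pts"
      then have "p + u \<in> pts" using add by simp
      with add p have "\<forall>\<^sub>F f in unit_filter. f (p + u + w + v) - f (p + u + w) = f (p + u + v) - f (p + u)"
        "\<forall>\<^sub>F f in unit_filter. f (p + u + v) - f (p + u) = f (p + v) - f p" by blast+
      then show "\<forall>\<^sub>F f in unit_filter. f (p + (u + w) + v) - f (p + (u + w)) = f (p + v) - f p"
        by eventually_elim (simp add: add.assoc)
    qed
  qed (use unit that in blast)
  then have unit_v: "\<forall>\<^sub>F f in unit_filter. f (p + w + v) - f (p + w) = f (p + v) - f p"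
    if "p \<in> pts" "v \<in> pts" "norm v = 1" for p v using that by blast
  have "\<forall>p\<in>pts. \<forall>\<^sub>F f in unit_filter. f (p + w + v) - f (p + w) = f (p + v) - f p"
    using \<open>v \<in> pts\<close>
  proof (induction v rule: pts_unit_induct)
    case (add u v)
    show ?case
    proof
      fix p assume p: "p \<in> pts"
      then have "p + u \<in> pts" using add by simp
      with add p have "\<forall>\<^sub>F f in unit_filter. f (p + w + u) - f (p + w) = f (p + u) - f p"
        "\<forall>\<^sub>F f in unit_filter. f (p + u + w + v) - f (p + u + w) = f (p + u + v) - f (p + u)" by blast+
      then show "\<forall>\<^sub>F f in unit_filter. f (p + w + (u + v)) - f (p + w) = f (p + (u + v)) - f p"
      proof eventually_elim
        case (elim f)
        have "p + w + (u + v) = p + u + w + v" "p + (u + v) = p + u + v" "p + w + u = p + u + w"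
          by simp_all
        moreover have "f (p + u + w + v) - f (p + w)
            = (f (p + u + w + v) - f (p + u + w)) + (f (p + u + w) - f (p + w))"
          by simp
        ultimately show ?case using elim by (simp only:) simp
      qed
    qed
  qed (use unit_v in blast)
  then show ?thesis using assms by blast
qed

section \<open>Displacements along a line of the plane\<close>

definition disp :: "real ^ 'n \<Rightarrow> (real ^ 'n \<Rightarrow> real ^ 'n) \<Rightarrow> real ^ 'n \<Rightarrow> real ^ 'n" where
  "disp p f v = f (p + v) - f p"

lemma eventually_disp_add:
  assumes "CARD('n) = 2" "p \<in> pts" "v \<in> pts" "w \<in> pts"
  shows "\<forall>\<^sub>F f in unit_filter. disp p f (v + w) = disp p f v + disp p f w"
  using eventually_translation[OF assms]
proof eventually_elim
  case (elim f)
  then have "f (p + v + w) = f (p + w) - f p + f (p + v)" by (simp only: diff_eq_eq)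
  then show ?case by (simp add: disp_def add.assoc)
qed

lemma eventually_norm_disp:
  assumes "p \<in> pts" "v \<in> pts" "norm v = r" "r \<in> \<rat>" "r > 0"
  shows "\<forall>\<^sub>F f in unit_filter. norm (disp p f v) = r"
  unfolding disp_def using assms by (intro rigidD rigid_Rats) auto

text \<open>With \<open>a = (t - 1/t) / 2\<close>, \<open>a' = (t + 1/t) / 2\<close> one has \<open>a'\<^sup>2 - a\<^sup>2 = 1\<close>, so \<open>a\<close> and \<open>a'\<close>
  are legs of two right triangles with the same other leg \<open>b\<close> and rational hypotenuses.
  Length preservation along both diagonals of each doubled triangle makes the images of the
  legs orthogonal.\<close>

lemma eventually_disp_inverse:
  assumes card: "CARD('n) = 2" and p: "p \<in> pts" and e: "e \<in> pts" "norm e = 1"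
    and t: "t \<in> K" "t \<noteq> 0"
  shows "\<forall>\<^sub>F f in unit_filter. disp p f (t *\<^sub>R e) \<noteq> 0 \<and>
    disp p f ((1 / t) *\<^sub>R e) =
      (1 / (disp p f (t *\<^sub>R e) \<bullet> disp p f (t *\<^sub>R e))) *\<^sub>R disp p f (t *\<^sub>R e)"
proof -
  obtain v where v: "v \<in> pts" "norm v = 1" "v \<bullet> e = 0"
    using exists_orthogonal_unit_pts_card[of "{e}"] e card by auto
  define a a' where "a = (t - 1 / t) / 2" and "a' = (t + 1 / t) / 2"
  have a: "a \<in> K" "a' \<in> K" using t by (auto simp: a_def a'_def)
  have aa: "a'\<^sup>2 = a\<^sup>2 + 1" using t by (simp add: a_def a'_def power2_eq_square field_simps)
  \<comment> \<open>\<open>r\<close>, \<open>r'\<close> repeat the formulas of \<open>a\<close>,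
    \<open>a'\<close> with a rational \<open>M\<close> in place of \<open>t\<close>, so their
    squares also differ by 1. \<open>M\<close> is large enough for \<open>\<bar>a\<bar> < r\<close>,
    which makes \<open>b\<close> positive.\<close>
  define M where "M = real (nat \<lceil>2 * \<bar>a\<bar>\<rceil> + 2)"
  have M: "M \<ge> 2 * \<bar>a\<bar> + 2" "M \<in> \<rat>" unfolding M_def by linarith simp
  then have M2: "M \<ge> 2" by linarith
  define r r' where "r = (M - 1 / M) / 2" and "r' = (M + 1 / M) / 2"
  have r: "r \<in> \<rat>" "r' \<in> \<rat>" using M by (auto simp: r_def r'_def)
  have rr: "r'\<^sup>2 = r\<^sup>2 + 1" using M2 by (simp add: r_def r'_def power2_eq_square field_simps)
  have "2 * \<bar>a\<bar> + 2 - 1 \<le> M - 1 / M" using M M2 by (intro diff_mono) simp_all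
  then have ra: "r > \<bar>a\<bar>" by (simp add: r_def)
  then have r0: "r > 0" by linarith
  have r': "r' > 0" using M2 by (simp add: r'_def add_pos_nonneg)
  define b where "b = sqrt (r\<^sup>2 - a\<^sup>2)"
  have "a\<^sup>2 < r\<^sup>2" using ra by (metis abs_ge_zero power2_abs power_strict_mono zero_less_numeral)
  then have b: "b > 0" "b \<in> K" "a\<^sup>2 + b\<^sup>2 = r\<^sup>2" "a'\<^sup>2 + b\<^sup>2 = r'\<^sup>2"
    using a Rats_K[OF r(1)] by (auto simp: b_def aa rr)
  have ee: "e \<bullet> e = 1" "v \<bullet> v = 1" "v \<bullet> e = 0" "e \<bullet> v = 0"
    using e v by (simp_all add: norm_eq_1 inner_commute)
  have n: "norm (s *\<^sub>R e + q *\<^sub>R v) = sqrt (s\<^sup>2 + q\<^sup>2)" for s q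
    unfolding norm_eq_sqrt_inner using ee
    by (simp add: inner_add_left inner_add_right power2_eq_square)
  have leg: "\<forall>\<^sub>F f in unit_filter. disp p f (s *\<^sub>R e) \<bullet> disp p f (b *\<^sub>R v) = 0 \<and>
      disp p f (s *\<^sub>R e) \<bullet> disp p f (s *\<^sub>R e) + disp p f (b *\<^sub>R v) \<bullet> disp p f (b *\<^sub>R v) = q\<^sup>2"
    if s: "s \<in> K" "s\<^sup>2 + b\<^sup>2 = q\<^sup>2" "q \<in> \<rat>" "q > 0" for s q
  proof -
    have pts: "s *\<^sub>R e \<in> pts" "b *\<^sub>R v \<in> pts" using s b e v by auto
    have "norm (s *\<^sub>R e + b *\<^sub>R v) = q" "norm (s *\<^sub>R e - b *\<^sub>R v) = q"
      using n[of s b] n[of s "- b"] s by simp_all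
    then have "\<forall>\<^sub>F f in unit_filter. norm (disp p f (s *\<^sub>R e + b *\<^sub>R v)) = q"
      "\<forall>\<^sub>F f in unit_filter. norm (disp p f (s *\<^sub>R e - b *\<^sub>R v)) = q"
      using pts s p by (auto intro!: eventually_norm_disp)
    moreover have "\<forall>\<^sub>F f in unit_filter.
        disp p f (s *\<^sub>R e + b *\<^sub>R v) = disp p f (s *\<^sub>R e) + disp p f (b *\<^sub>R v)"
      using eventually_disp_add[OF card p pts] .
    moreover have "\<forall>\<^sub>F f in unit_filter.
        disp p f (s *\<^sub>R e) = disp p f (s *\<^sub>R e - b *\<^sub>R v) + disp p f (b *\<^sub>R v)"
      using eventually_disp_add[OF card p, of "s *\<^sub>R e - b *\<^sub>R v" "b *\<^sub>R v"] pts by simp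
    ultimately show ?thesis
    proof eventually_elim
      case (elim f)
      define A B where "A = disp p f (s *\<^sub>R e)" and "B = disp p f (b *\<^sub>R v)"
      have "norm (A + B) = q" "norm (A - B) = q"
        using elim by (simp_all add: A_def B_def)
      then have "(A + B) \<bullet> (A + B) = q\<^sup>2" "(A - B) \<bullet> (A - B) = q\<^sup>2"
        by (simp_all add: power2_norm_eq_inner[symmetric])
      then have "A \<bullet> B = 0 \<and> A \<bullet> A + B \<bullet> B = q\<^sup>2"
        by (simp add: inner_add_left inner_add_right inner_diff_left inner_diff_right inner_commute)
      then show ?case by (simp add: A_def B_def)
    qed
  qed
  have "\<forall>\<^sub>F f in unit_filter. disp p f (t *\<^sub>R e) = disp p f (a' *\<^sub>R e) + disp p f (a *\<^sub>R e)"
    using eventually_disp_add[OF card p, of "a' *\<^sub>R e" "a *\<^sub>R e"] a e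
    by (simp add: scaleR_left_distrib[symmetric] a_def a'_def field_simps)
  moreover have "\<forall>\<^sub>F f in unit_filter.
      disp p f (a' *\<^sub>R e) = disp p f ((1 / t) *\<^sub>R e) + disp p f (a *\<^sub>R e)"
  proof -
    have "(1 / t) *\<^sub>R e + a *\<^sub>R e = a' *\<^sub>R e"
      by (simp add: scaleR_left_distrib[symmetric] a_def a'_def diff_divide_distrib add_divide_distrib)
    then show ?thesis
      using eventually_disp_add[OF card p, of "(1 / t) *\<^sub>R e" "a *\<^sub>R e"] a e t by simp
  qed
  moreover have "\<forall>\<^sub>F f in unit_filter. disp p f (b *\<^sub>R v) \<noteq> 0"
  proof -
    have "p + b *\<^sub>R v \<noteq> p" using b v by auto
    then have "\<forall>\<^sub>F f in unit_filter. f (p + b *\<^sub>R v) \<noteq> f p"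
      using p b v by (intro eventually_neq) auto
    then show ?thesis by eventually_elim (simp add: disp_def)
  qed
  moreover note leg[OF a(1) b(3) r(1) r0] leg[OF a(2) b(4) r(2) r']
  ultimately show ?thesis
  proof eventually_elim
    case (elim f)
    define A A' B where "A = disp p f (a *\<^sub>R e)" and "A' = disp p f (a' *\<^sub>R e)"
      and "B = disp p f (b *\<^sub>R v)"
    define x y where "x = disp p f (t *\<^sub>R e)" and "y = disp p f ((1 / t) *\<^sub>R e)"
    have xy: "x = A' + A" "y = A' - A" using elim by (simp_all add: A_def A'_def x_def y_def)
    have AB: "A \<bullet> B = 0" "A' \<bullet> B = 0" "A \<bullet> A + B \<bullet> B = r\<^sup>2" "A' \<bullet> A' + B \<bullet> B = r'\<^sup>2" "B \<noteq> 0"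
      using elim by (simp_all add: A_def A'_def B_def)
    \<comment> \<open>\<open>x \<bullet> y\<close> is the difference of the squared lengths of
      \<open>A'\<close> and \<open>A\<close>, hence \<open>r'\<^sup>2 - r\<^sup>2 = 1\<close>. As
      \<open>x\<close> and \<open>y\<close> are both normal to \<open>B\<close>, they are inverse
      points.\<close>
    have xy1: "x \<bullet> y = 1"
      using AB rr by (simp add: xy inner_add_left inner_add_right inner_diff_left inner_diff_right inner_commute)
    moreover have "x \<bullet> B = 0" "y \<bullet> B = 0" using AB by (simp_all add: xy inner_add_left inner_diff_left)
    ultimately have "y = (1 / (x \<bullet> x)) *\<^sub>R x" using normal_line_inversion[OF card AB(5)] by blast
    moreover have "x \<noteq> 0" using xy1 by auto
    ultimately show ?case unfolding x_def y_def by simp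
  qed
qed

text \<open>The chart is quantified inside the filter because it is chosen after \<open>f\<close>,
  normalised to 1 at the displacement of \<open>e\<close>.\<close>

lemma eventually_chart_add:
  assumes "CARD('n) = 2" "p \<in> pts" "e \<in> pts" "s \<in> K" "t \<in> K"
  shows "\<forall>\<^sub>F f in unit_filter. \<forall>\<phi>. planar_chart \<phi> \<longrightarrow>
    \<phi> (disp p f ((s + t) *\<^sub>R e)) = \<phi> (disp p f (s *\<^sub>R e)) + \<phi> (disp p f (t *\<^sub>R e))"
proof -
  have "\<forall>\<^sub>F f in unit_filter.
      disp p f (s *\<^sub>R e + t *\<^sub>R e) = disp p f (s *\<^sub>R e) + disp p f (t *\<^sub>R e)"
    using assms by (intro eventually_disp_add) auto
  then show ?thesis
    by eventually_elim (simp add: scaleR_left_distrib planar_chart_def linear_add)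
qed

lemma eventually_chart_inverse:
  assumes "CARD('n) = 2" "p \<in> pts" "e \<in> pts" "norm e = 1" "t \<in> K" "t \<noteq> 0"
  shows "\<forall>\<^sub>F f in unit_filter. \<forall>\<phi>. planar_chart \<phi> \<longrightarrow>
    \<phi> (disp p f (t *\<^sub>R e)) \<noteq> 0 \<and>
    \<phi> (disp p f ((1 / t) *\<^sub>R e)) = inverse (cnj (\<phi> (disp p f (t *\<^sub>R e))))"
  using eventually_disp_inverse[OF assms]
proof eventually_elim
  case (elim f)
  have "\<phi> (disp p f (t *\<^sub>R e)) \<noteq> 0" if "planar_chart \<phi>" for \<phi>
  proof -
    have "cmod (\<phi> (disp p f (t *\<^sub>R e))) \<noteq> 0" using that elim by (simp add: planar_chart_def)
    then show ?thesis by simp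
  qed
  then show ?case using elim planar_chart_inversion by metis
qed

text \<open>Hua's identity \<open>s - s\<^sup>2 = 1 / (1/s + 1/(1 - s))\<close>: the two complex conjugations cancel.\<close>

lemma eventually_chart_square:
  assumes card: "CARD('n) = 2" and p: "p \<in> pts" and e: "e \<in> pts" "norm e = 1" and s: "s \<in> K"
  shows "\<forall>\<^sub>F f in unit_filter. \<forall>\<phi>. planar_chart \<phi> \<longrightarrow> \<phi> (disp p f e) = 1 \<longrightarrow>
    \<phi> (disp p f (s\<^sup>2 *\<^sub>R e)) = (\<phi> (disp p f (s *\<^sub>R e)))\<^sup>2"
proof (cases "s = 0 \<or> s = 1")
  case True
  then show ?thesis
    by (auto simp: disp_def planar_chart_def linear_0 intro!: always_eventually)
next
  case False
  define c where "c = s - s\<^sup>2"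
  have c: "c = s * (1 - s)" "c \<noteq> 0" "c \<in> K" using False s by (auto simp: c_def power2_eq_square algebra_simps)
  have s': "s \<noteq> 0" "1 - s \<in> K" "1 - s \<noteq> 0" using False s by auto
  have "1 / s + 1 / (1 - s) = 1 / c" using False by (simp add: c(1) field_simps)
  then have "\<forall>\<^sub>F f in unit_filter. \<forall>\<phi>. planar_chart \<phi> \<longrightarrow>
      \<phi> (disp p f ((1 / c) *\<^sub>R e)) = \<phi> (disp p f ((1 / s) *\<^sub>R e)) + \<phi> (disp p f ((1 / (1 - s)) *\<^sub>R e))"
    using eventually_chart_add[OF card p e(1), of "1 / s" "1 / (1 - s)"] s by simp
  moreover have "\<forall>\<^sub>F f in unit_filter. \<forall>\<phi>. planar_chart \<phi> \<longrightarrow>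
      \<phi> (disp p f (s *\<^sub>R e)) = \<phi> (disp p f (s\<^sup>2 *\<^sub>R e)) + \<phi> (disp p f (c *\<^sub>R e))"
    using eventually_chart_add[OF card p e(1), of "s\<^sup>2" c] s c by (simp add: c_def)
  moreover have "\<forall>\<^sub>F f in unit_filter. \<forall>\<phi>. planar_chart \<phi> \<longrightarrow>
      \<phi> (disp p f e) = \<phi> (disp p f (s *\<^sub>R e)) + \<phi> (disp p f ((1 - s) *\<^sub>R e))"
    using eventually_chart_add[OF card p e(1), of s "1 - s"] s by simp
  moreover note eventually_chart_inverse[OF card p e s s'(1)] eventually_chart_inverse[OF card p e s'(2,3)]
    eventually_chart_inverse[OF card p e c(3,2)]
  ultimately show ?thesis
  proof eventually_elim
    case (elim f)
    show ?case
    proof (intro allI impI)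
      fix \<phi> :: "real ^ 'n \<Rightarrow> complex"
      assume \<phi>: "planar_chart \<phi>" "\<phi> (disp p f e) = 1"
      define x where "x = \<phi> (disp p f (s *\<^sub>R e))"
      define z where "z = \<phi> (disp p f (c *\<^sub>R e))"
      have 1: "\<phi> (disp p f ((1 - s) *\<^sub>R e)) = 1 - x"
        using elim(3) \<phi> by (simp add: x_def algebra_simps)
      have x: "x \<noteq> 0" "1 - x \<noteq> 0" "z \<noteq> 0"
        using elim(4,5,6) \<phi> 1 by (auto simp: x_def z_def)
      note inv = elim(4-6)[rule_format, OF \<phi>(1), THEN conjunct2, folded x_def z_def, unfolded 1]
      have "inverse (cnj z) = inverse (cnj x) + inverse (cnj (1 - x))"
        using elim(1)[rule_format, OF \<phi>(1)] unfolding inv .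
      then have "cnj (inverse (cnj z)) = cnj (inverse (cnj x) + inverse (cnj (1 - x)))"
        by (rule arg_cong)
      then have "inverse z = inverse x + inverse (1 - x)" by simp
      then have "z = x * (1 - x)" using x by (simp add: field_simps)
      moreover have "x = \<phi> (disp p f (s\<^sup>2 *\<^sub>R e)) + z"
        using elim(2) \<phi>(1) unfolding x_def z_def by blast
      ultimately have "\<phi> (disp p f (s\<^sup>2 *\<^sub>R e)) = x\<^sup>2"
        by (simp add: power2_eq_square algebra_simps)
      then show "\<phi> (disp p f (s\<^sup>2 *\<^sub>R e)) = (\<phi> (disp p f (s *\<^sub>R e)))\<^sup>2"
        by (simp add: x_def)
    qed
  qed
qed

text \<open>Squares are preserved, hence products; applied to \<open>t\<close> and \<open>1/t\<close> this makes the images of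
  \<open>t\<close> and \<open>1/t\<close> inverse to each other, whereas they are also conjugate-inverse.\<close>

lemma eventually_chart_real:
  assumes card: "CARD('n) = 2" and p: "p \<in> pts" and e: "e \<in> pts" "norm e = 1" and t: "t \<in> K"
  shows "\<forall>\<^sub>F f in unit_filter. \<forall>\<phi>. planar_chart \<phi> \<longrightarrow> \<phi> (disp p f e) = 1 \<longrightarrow>
    \<phi> (disp p f (t *\<^sub>R e)) \<in> \<real>"
proof (cases "t = 0")
  case True
  then show ?thesis
    by (auto simp: disp_def planar_chart_def linear_0 intro!: always_eventually)
next
  case False
  define s where "s = 1 / t"
  have s: "s \<in> K" using t by (simp add: s_def)
  \<comment> \<open>As \<open>t * s = 1\<close>, the cross term is 2. It is written
    \<open>1 + 1\<close> so that additivity evaluates it from the value 1 at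
    \<open>e\<close>.\<close>
  have sq: "(t + s)\<^sup>2 = t\<^sup>2 + (s\<^sup>2 + (1 + 1))"
    using False by (simp add: s_def power2_eq_square field_simps)
  have K: "s\<^sup>2 + (1 + 1) \<in> K" "1 + 1 \<in> K" by (intro K_add K_power s K_1)+
  note add = eventually_chart_add[OF card p e(1)]
  have "\<forall>\<^sub>F f in unit_filter. \<forall>\<phi>. planar_chart \<phi> \<longrightarrow> \<phi> (disp p f e) = 1 \<longrightarrow>
      \<phi> (disp p f ((t + s)\<^sup>2 *\<^sub>R e)) = \<phi> (disp p f (t\<^sup>2 *\<^sub>R e)) + (\<phi> (disp p f (s\<^sup>2 *\<^sub>R e)) + 2)"
    unfolding sq
    using add[OF K_power[OF t, of 2] K(1)] add[OF K_power[OF s, of 2] K(2)] add[OF K_1 K_1]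
  proof eventually_elim
    case (elim f)
    show ?case
    proof (intro allI impI)
      fix \<phi> :: "real ^ 'n \<Rightarrow> complex"
      assume \<phi>: "planar_chart \<phi>" "\<phi> (disp p f e) = 1"
      show "\<phi> (disp p f ((t\<^sup>2 + (s\<^sup>2 + (1 + 1))) *\<^sub>R e))
          = \<phi> (disp p f (t\<^sup>2 *\<^sub>R e)) + (\<phi> (disp p f (s\<^sup>2 *\<^sub>R e)) + 2)"
        unfolding elim[rule_format, OF \<phi>(1)] by (simp add: \<phi>(2))
    qed
  qed
  moreover have "\<forall>\<^sub>F f in unit_filter. \<forall>\<phi>. planar_chart \<phi> \<longrightarrow>
      \<phi> (disp p f ((t + s) *\<^sub>R e)) = \<phi> (disp p f (t *\<^sub>R e)) + \<phi> (disp p f (s *\<^sub>R e))"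
    using add[OF t s] .
  moreover note eventually_chart_square[OF card p e t] eventually_chart_square[OF card p e s]
    eventually_chart_square[OF card p e K_add[OF t s]]
    eventually_chart_inverse[OF card p e t False, folded s_def]
  ultimately show ?thesis
  proof eventually_elim
    case (elim f)
    show ?case
    proof (intro allI impI)
      fix \<phi> :: "real ^ 'n \<Rightarrow> complex"
      assume \<phi>: "planar_chart \<phi>" "\<phi> (disp p f e) = 1"
      define x y where "x = \<phi> (disp p f (t *\<^sub>R e))" and "y = \<phi> (disp p f (s *\<^sub>R e))"
      have "(x + y)\<^sup>2 = x\<^sup>2 + (y\<^sup>2 + 2)"
        using elim \<phi> by (simp add: x_def y_def)
      then have "x * y = 1" by (simp add: power2_eq_square algebra_simps)
      moreover have "y = inverse (cnj x)" "x \<noteq> 0" using elim(6) \<phi> by (auto simp: x_def y_def)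
      ultimately have "cnj x = x" by (simp add: field_simps)
      then show "\<phi> (disp p f (t *\<^sub>R e)) \<in> \<real>" by (simp add: x_def Reals_cnj_iff)
    qed
  qed
qed

section \<open>Common normals of the image points\<close>

lemma eventually_common_normal_plane:
  assumes card: "CARD('n) = 2" and I: "finite I" "\<And>i. i \<in> I \<Longrightarrow> X i \<in> pts" and p: "p \<in> pts"
    and v: "v \<in> pts" "norm v = 1" "\<And>i. i \<in> I \<Longrightarrow> v \<bullet> (X i - p) = 0"
  shows "\<forall>\<^sub>F f in unit_filter. \<exists>w. w \<noteq> 0 \<and> (\<forall>i\<in>I. w \<bullet> (f (X i) - f p) = 0)"
proof -
  obtain e where e: "e \<in> pts" "norm e = 1" "e \<bullet> v = 0"
    using exists_orthogonal_unit_pts_card[of "{v}"] v card by auto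
  have nz: "v \<noteq> 0" "e \<noteq> 0" using v e by auto
  \<comment> \<open>The points lie on the line through \<open>p\<close> with direction
    \<open>e\<close>. Their image displacements turn out to be real multiples of that of
    \<open>e\<close>, so any normal of the latter works.\<close>
  define t where "t i = (X i - p) \<bullet> e" for i
  have t: "t i \<in> K" if "i \<in> I" for i using that I p e by (simp add: t_def)
  have X: "X i = p + t i *\<^sub>R e" if "i \<in> I" for i
  proof -
    have "X i - p - t i *\<^sub>R e = 0"
      using e v(3)[OF that]
      by (intro orthogonal_pair_complement_trivial[OF card nz(2,1) e(3)])
        (simp_all add: inner_diff_left inner_diff_right t_def norm_eq_1 inner_commute[of _ v])
    then show ?thesis by (simp add: diff_eq_eq add.commute)
  qed
  have "\<forall>\<^sub>F f in unit_filter. norm (disp p f e) = 1"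
    using p e by (intro eventually_norm_disp) auto
  moreover have "\<forall>\<^sub>F f in unit_filter. \<forall>i\<in>I. \<forall>\<phi>. planar_chart \<phi> \<longrightarrow> \<phi> (disp p f e) = 1 \<longrightarrow>
      \<phi> (disp p f (t i *\<^sub>R e)) \<in> \<real>"
    using I(1) t by (intro eventually_ball_finite ballI eventually_chart_real card p e)
  ultimately show ?thesis
  proof eventually_elim
    case (elim f)
    obtain \<phi> where \<phi>: "planar_chart \<phi>" "\<phi> (disp p f e) = 1"
      using planar_chart_exists[OF card elim(1)] by blast
    obtain w where w: "w \<noteq> 0" "w \<bullet> disp p f e = 0"
      using orthogonal_to_vector_exists[of "disp p f e"] card
      by (auto simp: orthogonal_def inner_commute)
    have "w \<bullet> (f (X i) - f p) = 0" if "i \<in> I" for i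
    proof -
      obtain r where r: "\<phi> (disp p f (t i *\<^sub>R e)) = of_real r"
        using elim(2) \<phi> \<open>i \<in> I\<close> by (meson Reals_cases)
      have "\<phi> (disp p f (t i *\<^sub>R e) - r *\<^sub>R disp p f e) = 0"
        using \<phi> r by (simp add: planar_chart_def linear_diff linear_scale)
          (simp add: scaleR_conv_of_real)
      then have "norm (disp p f (t i *\<^sub>R e) - r *\<^sub>R disp p f e) = 0"
        using \<phi>(1) by (metis norm_zero planar_chart_def)
      then have "f (X i) - f p = r *\<^sub>R disp p f e" by (simp add: X[OF that] disp_def)
      then show ?thesis using w by simp
    qed
    then show ?case using w by blast
  qed
qed

lemma eventually_common_normal:
  assumes I: "finite I" "\<And>i. i \<in> I \<Longrightarrow> X i \<in> pts" and p: "p \<in> pts"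
    and v: "v \<in> pts" "norm v = 1" "\<And>i. i \<in> I \<Longrightarrow> v \<bullet> (X i - p) = 0"
  shows "\<forall>\<^sub>F f in unit_filter. \<exists>w. w \<noteq> 0 \<and> (\<forall>i\<in>I. w \<bullet> (f (X i) - f p) = 0)"
proof (cases "CARD('n) = 2")
  case True
  then show ?thesis using eventually_common_normal_plane assms by blast
next
  case False
  then have card: "CARD('n) > 2" using card_ge_2 by simp
  \<comment> \<open>Length 4 fits the 3-4-5 rectangles and, being rigid, makes the common normal
    \<open>f (p + w) - f p\<close> nonzero.\<close>
  define w where "w = 4 *\<^sub>R v"
  have w: "w \<in> pts" "norm w = 4" using v by (auto simp: w_def)
  have "\<forall>\<^sub>F f in unit_filter. norm (f (p + w) - f p) = 4"
    using p w by (intro rigidD rigid_Rats) auto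
  moreover have "\<forall>\<^sub>F f in unit_filter. \<forall>i\<in>I. f (X i + w) - f (X i) = f (p + w) - f p \<and>
      (f (X i) - f p) \<bullet> (f (p + w) - f p) = 0"
    using I v(3) by (intro eventually_ball_finite ballI eventually_orthogonal_transport card w p)
      (auto simp: w_def inner_commute[of _ v])
  ultimately show ?thesis
  proof eventually_elim
    case (elim f)
    then show ?case
      by (intro exI[of _ "f (p + w) - f p"]) (auto simp: inner_commute)
  qed
qed

text \<open>The normal \<open>a\<close> of the given hyperplane need not be over \<open>K\<close>,
  but it shows that the differences of the points span a proper subspace, and this already provides
  a normal \<open>v\<close> over \<open>K\<close>.\<close>

lemma affine_hyperplane_preserving_set:
  fixes X :: "nat \<Rightarrow> real ^ 'n"
  assumes H: "affine_hyperplane H" "\<And>i. i \<in> I \<Longrightarrow> X i \<in> H"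
    and I: "finite I" "\<And>i. i \<in> I \<Longrightarrow> X i \<in> pts"
  shows "\<exists>L. finite L \<and> (\<forall>i\<in>I. X i \<in> L) \<and> L \<subseteq> pts \<and>
    (\<forall>f. preserves_unit_distances L f \<longrightarrow>
      (\<exists>H. affine_hyperplane H \<and> (\<forall>i\<in>I. f (X i) \<in> H)))"
proof (cases "I = {}")
  case True
  then show ?thesis using H(1) by (intro exI[of _ "{}"]) auto
next
  case False
  then obtain j where j: "j \<in> I" by blast
  have H': "affine hull H = H" "aff_dim H = int (DIM(real ^ 'n) - 1)"
    using H(1) card_ge_2 by (auto simp: affine_hyperplane_def hull_same of_nat_diff)
  have "\<exists>a b. a \<noteq> 0 \<and> affine hull H = {x. a \<bullet> x = b}"
    using H'(2) by (simp only: aff_dim_eq_hyperplane)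
  then obtain a b where a: "a \<noteq> 0" "H = {x. a \<bullet> x = b}"
    unfolding H'(1) by (elim exE conjE)
  define S where "S = (\<lambda>i. X i - X j) ` I"
  have "S \<subseteq> {x. a \<bullet> x = 0}" using H(2) j by (auto simp: S_def a(2) inner_diff_right)
  then have "span S \<subseteq> {x. a \<bullet> x = 0}" by (rule span_minimal) (rule subspace_hyperplane)
  then have "a \<notin> span S" using a(1) by auto
  then have "span S \<noteq> UNIV" by auto
  then obtain v where v: "v \<in> pts" "norm v = 1" "\<And>s. s \<in> S \<Longrightarrow> v \<bullet> s = 0"
    using exists_orthogonal_unit_pts[of S] I j by (auto simp: S_def)
  have "\<forall>\<^sub>F f in unit_filter. \<exists>w. w \<noteq> 0 \<and> (\<forall>i\<in>I. w \<bullet> (f (X i) - f (X j)) = 0)"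
    using I j v by (intro eventually_common_normal[where v = v]) (auto simp: S_def)
  then obtain L where L: "finite L" "L \<subseteq> pts" "\<And>f. preserves_unit_distances L f \<Longrightarrow>
      \<exists>w. w \<noteq> 0 \<and> (\<forall>i\<in>I. w \<bullet> (f (X i) - f (X j)) = 0)"
    unfolding eventually_unit_filter by blast
  show ?thesis
  \<comment> \<open>The points themselves are adjoined; enlarging the finite set only strengthens
    the condition on \<open>f\<close>.\<close>
  proof (rule exI[of _ "L \<union> X ` I"], intro conjI allI impI)
    fix f :: "real ^ 'n \<Rightarrow> real ^ 'n"
    assume "preserves_unit_distances (L \<union> X ` I) f"
    then have "preserves_unit_distances L f" by (auto simp: preserves_unit_distances_def)
    then obtain w where w: "w \<noteq> 0" "\<forall>i\<in>I. w \<bullet> (f (X i) - f (X j)) = 0" using L(3) by blast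
    show "\<exists>H. affine_hyperplane H \<and> (\<forall>i\<in>I. f (X i) \<in> H)"
      using w card_ge_2
      by (intro exI[of _ "{x. w \<bullet> x = w \<bullet> f (X j)}"])
        (auto simp: affine_hyperplane_def affine_hyperplane aff_dim_hyperplane inner_diff_right of_nat_diff)
  qed (use L I in auto)
qed

end

theorem theorem3:
  fixes X :: "nat \<Rightarrow> real ^ 'n" and m :: nat
  assumes "CARD('n) > 1"
    and "\<exists>H. affine_hyperplane H \<and> (\<forall>i\<in>{1..m}. X i \<in> H)"
  shows "(\<exists>L. finite L \<and> (\<forall>i\<in>{1..m}. X i \<in> L) \<and>
            (\<forall>f. preserves_unit_distances L f \<longrightarrow>
               (\<exists>H. affine_hyperplane H \<and> (\<forall>i\<in>{1..m}. f (X i) \<in> H)))) \<and>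
         ((\<forall>i\<in>{1..m}. X i \<in> constructible_points) \<longrightarrow>
          (\<exists>L. finite L \<and> (\<forall>i\<in>{1..m}. X i \<in> L) \<and> L \<subseteq> constructible_points \<and>
            (\<forall>f. preserves_unit_distances L f \<longrightarrow>
               (\<exists>H. affine_hyperplane H \<and> (\<forall>i\<in>{1..m}. f (X i) \<in> H)))))"
proof -
  \<comment> \<open>One argument over two fields: the reals for the first claim, the constructible
    numbers for the second.\<close>
  interpret real_field: euclidean_field UNIV "TYPE('n)"
    using assms(1) by unfold_locales auto
  interpret constructible_field: euclidean_field constructible "TYPE('n)"
    using assms(1) by unfold_locales (auto intro: constructible.intros)
  obtain H where H: "affine_hyperplane H" "\<And>i. i \<in> {1..m} \<Longrightarrow> X i \<in> H"
    using assms(2) by blast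
  have pts: "real_field.pts = UNIV" "constructible_field.pts = constructible_points"
    by (auto simp: real_field.pts_def constructible_field.pts_def constructible_points_def)
  show ?thesis
    using real_field.affine_hyperplane_preserving_set[of H "{1..m}" X, OF H]
      constructible_field.affine_hyperplane_preserving_set[of H "{1..m}" X, OF H]
    unfolding pts by auto
qed

end
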